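(* Let $A$ be a cyclic division algebra over $\mathbb{Q}$ of degree $3$ (so of dimension $9$ over $\mathbb{Q}$) with a canonical generation $(\sigma, Z, S)$, and let $\mathfrak{m}$ be a maximal order of $A$ associated with this canonical generation. If $\sigma \equiv 1 \pmod 2$, then for every integer $r \ge 2$, every matrix $C \in M_r(\mathfrak{m})$ is a (finite) sum of squares of matrices in $M_r(\mathfrak{m})$.
   Context: All notions are given for degree $n$ an odd prime; the claim uses $n=3$. Cyclic algebra. Let $Z/\mathbb{Q}$ be a cyclic field extension of degree $n$, let $S$ be a generator of its Galois group (write $z^S$ for the image of $z$ under $S$), and let $\sigma \in \mathbb{Q}$, $\sigma\neq 0$. The cyclic algebra $(\sigma, Z, S)$ is the $\mathbb{Q}$-algebra $\bigoplus_{i=0}^{n-1} u^i Z$ of dimension $n^2$ over $\mathbb{Q}$, with multiplication determined by $zu = u z^S$ for $z\in Z$ and $u^n = \sigma$. A cyclic generation of $A$ is a presentation $A = (\sigma, Z, S)$. Canonical generation. Let $A$ be a cyclic division algebra of odd prime degree $n$ over $\mathbb{Q}$, and let $q_1,\dots,q_s$ ($s\ge 2$) be the distinct rational primes at which $A$ does not split. A canonical generation of $A$ is a cyclic generation $A=(\sigma, Z, S)$ such that $\sigma = q_1 q_2\cdots q_s$ and, for some rational prime $p$: $p\equiv 1 \pmod n$; $p \nmid \sigma$; each $q_i$ is not an $n$-th power modulo $p$; $\sigma$ is an $n$-th power modulo $p$; $Z$ is the unique cyclic field of degree $n$ over $\mathbb{Q}$ of conductor $p$ (discriminant $p^{n-1}$);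 and $S$ is a generator of $\mathrm{Gal}(Z/\mathbb{Q})$. Associated maximal order. Given such a canonical generation, write $p = hn+1$, let $g$ be a primitive root modulo $p$ and $\xi$ a primitive $p$-th root of unity. Put $\eta = \sum_{r=0}^{h-1} \xi^{g^{nr}}$ (the Gaussian period), so $Z = \mathbb{Q}(\eta)$, and the conjugates $\eta, \eta^S, \dots, \eta^{S^{n-1}}$ form a normal $\mathbb{Z}$-basis of the ring of integers of $Z$. Put $\beta = \prod_{r=0}^{h-1}(1-\xi^{g^{nr}}) \in Z$ and $\alpha = \beta^{n-1}$. Let $\lambda$ be a rational integer with $\lambda^n \equiv \sigma \pmod p$, and define $y\in A$ by $py = (\lambda - u)\alpha$. The set $I(\lambda)$ of all $\mathbb{Z}$-linear combinations of the elements $y^i \eta^{S^k}$, $0\le i,k\le n-1$, is a maximal order in $A$ (a theorem of R. Hull). A maximal order associated with the canonical generation is any $\mathfrak{m}= I(\lambda)$ of this form. $M_r(\mathfrak{m})$ denotes the ring of $r\times r$ matrices over $\mathfrak{m}$. *)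

theory Defs
  imports
    Complex_Main
    "HOL-Number_Theory.Number_Theory"
    "HOL-Algebra.Bij"
    "HOL-Algebra.Generated_Groups"
    "HOL-Algebra.QuotRing"
    "Jordan_Normal_Form.Matrix"
begin

section \<open>Division rings of characteristic zero as rational vector spaces\<close>

text \<open>The library's \<open>of_rat\<close> is only available on (commutative) fields.\<close>

definition rat_scale :: "rat \<Rightarrow> 'a \<Rightarrow> 'a :: {division_ring, ring_char_0}" where
  "rat_scale q x = of_int (fst (quotient_of q)) / of_int (snd (quotient_of q)) * x"

lemma rat_scale_spec:
  fixes x :: "'a :: {division_ring, ring_char_0}"
  assumes "of_int b * q = of_int a"
  shows "of_int b * rat_scale q x = of_int a * x"
proof -
  obtain c d where cd: "quotient_of q = (c, d)"
    by force
  have d0: "d \<noteq> 0"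
    using quotient_of_denom_pos[OF cd] by simp
  have "q = of_int c / of_int d"
    by (rule quotient_of_div[OF cd])
  then have qd: "q * of_int d = of_int c"
    using d0 by simp
  have "of_int (b * c) = (of_int b * q) * of_int d"
    by (simp only: of_int_mult mult.assoc qd)
  also have "\<dots> = (of_int (a * d) :: rat)"
    by (simp only: assms of_int_mult)
  finally have "b * c = a * d"
    by (simp only: of_int_eq_iff)
  then have "of_int b * of_int c = (of_int a * of_int d :: 'a)"
    by (simp only: of_int_mult[symmetric])
  then have "of_int b * (of_int c / of_int d) = (of_int a :: 'a)"
    using d0 by (simp only: times_divide_eq_right) (simp add: divide_inverse mult.assoc)
  then show ?thesis
    by (simp add: rat_scale_def cd flip: mult.assoc)
qed

lemma rat_scale_unique:
  fixes x y :: "'a :: {division_ring, ring_char_0}"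
  assumes "b \<noteq> 0" "of_int b * q = of_int a" "of_int b * y = of_int a * x"
  shows "rat_scale q x = y"
proof -
  have "of_int b * rat_scale q x = of_int b * y"
    using rat_scale_spec[OF assms(2), of x] assms(3) by simp
  then show ?thesis
    using assms(1) by (simp only: mult_left_cancel of_int_eq_0_iff not_False_eq_True)
qed

lemma rat_common_denom:
  fixes p q :: rat
  obtains d a b where "d \<noteq> 0" "of_int d * p = of_int a" "of_int d * q = of_int b"
proof -
  obtain a1 d1 where p: "quotient_of p = (a1, d1)"
    by force
  obtain a2 d2 where q: "quotient_of q = (a2, d2)"
    by force
  show ?thesis
    using that[of "d1 * d2" "a1 * d2" "a2 * d1"] quotient_of_div[OF p] quotient_of_div[OF q]
      quotient_of_denom_pos[OF p] quotient_of_denom_pos[OF q]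
    by simp
qed

interpretation rat_vs: vector_space "rat_scale :: rat \<Rightarrow> 'a \<Rightarrow> 'a :: {division_ring, ring_char_0}"
proof
  fix p q :: rat and x y :: 'a
  obtain d a b where d: "d \<noteq> 0" "of_int d * p = of_int a" "of_int d * q = of_int b"
    using rat_common_denom .
  show "rat_scale p (x + y) = rat_scale p x + rat_scale p y"
    by (rule rat_scale_unique[OF d(1,2)]) (simp add: distrib_left rat_scale_spec[OF d(2)])
  show "rat_scale (p + q) x = rat_scale p x + rat_scale q x"
    by (rule rat_scale_unique[of d _ "a + b"])
       (use d in \<open>simp_all add: distrib_left distrib_right rat_scale_spec[OF d(2)] rat_scale_spec[OF d(3)]\<close>)
  have "of_int (d * d) * (p * q) = of_int d * p * (of_int d * q)"
    by simp
  then have pq: "of_int (d * d) * (p * q) = of_int (a * b)"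
    by (simp only: d of_int_mult)
  have "of_int (d * d) * rat_scale p (rat_scale q x) = of_int d * of_int a * rat_scale q x"
    by (simp add: mult.assoc rat_scale_spec[OF d(2)])
  also have "of_int d * of_int a = (of_int a * of_int d :: 'a)"
    by (rule mult_of_int_commute)
  finally have "of_int (d * d) * rat_scale p (rat_scale q x) = of_int (a * b) * x"
    by (simp add: mult.assoc rat_scale_spec[OF d(3)])
  then show "rat_scale p (rat_scale q x) = rat_scale (p * q) x"
    by (intro rat_scale_unique[OF _ pq, symmetric]) (use d(1) in simp_all)
  show "rat_scale 1 x = x"
    by (simp add: rat_scale_def)
qed


section \<open>Cyclic number fields\<close>

text \<open>Number fields are realised inside \<open>\<complex>\<close>.\<close>

definition is_subfield :: "complex set \<Rightarrow> bool" where
  "is_subfield F \<longleftrightarrow> 0 \<in> F \<and> 1 \<in> F \<and>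
     (\<forall>x\<in>F. \<forall>y\<in>F. x + y \<in> F \<and> x * y \<in> F) \<and> (\<forall>x\<in>F. - x \<in> F \<and> inverse x \<in> F)"

definition Gal :: "complex set \<Rightarrow> (complex \<Rightarrow> complex) monoid" where
  "Gal F = BijGroup F \<lparr>carrier := {f \<in> Bij F.
     (\<forall>x\<in>F. \<forall>y\<in>F. f (x + y) = f x + f y \<and> f (x * y) = f x * f y) \<and> (\<forall>q. f (of_rat q) = of_rat q)}\<rparr>"

text \<open>A finite extension is Galois iff it has as many automorphisms as its degree.\<close>

definition cyclic_field :: "nat \<Rightarrow> complex set \<Rightarrow> (complex \<Rightarrow> complex) \<Rightarrow> bool" where
  "cyclic_field n Z S \<longleftrightarrow> is_subfield Z \<and> rat_vs.dim Z = n \<and> order (Gal Z) = n \<and>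
     S \<in> carrier (Gal Z) \<and> generate (Gal Z) {S} = carrier (Gal Z)"

definition cyclotomic_field :: "nat \<Rightarrow> complex set" where
  "cyclotomic_field m = is_subfield hull {cis (2 * pi / real m)}"

text \<open>\<open>Z\<close> is meant to be abelian over \<open>\<rat>\<close>.\<close>

definition has_conductor :: "complex set \<Rightarrow> nat \<Rightarrow> bool" where
  "has_conductor Z m \<longleftrightarrow> m > 0 \<and> Z \<subseteq> cyclotomic_field m \<and>
     (\<forall>k. 0 < k \<and> k < m \<longrightarrow> \<not> Z \<subseteq> cyclotomic_field k)"


section \<open>Cyclic algebras\<close>

text \<open>
  The algebra \<open>A\<close> is the whole type \<^typ>\<open>'a\<close>; \<open>\<iota>\<close> embeds \<open>Z\<close> into it. The last conjunct says that
  \<open>A\<close> is the direct sum of the subspaces \<open>u\<^sup>i Z\<close> with \<open>i < n\<close>.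
\<close>

definition cyclic_generation ::
  "nat \<Rightarrow> rat \<Rightarrow> complex set \<Rightarrow> (complex \<Rightarrow> complex) \<Rightarrow>
   (complex \<Rightarrow> 'a :: {division_ring, ring_char_0}) \<Rightarrow> 'a \<Rightarrow> bool" where
  "cyclic_generation n \<sigma> Z S \<iota> u \<longleftrightarrow>
     \<sigma> \<noteq> 0 \<and> cyclic_field n Z S \<and>
     \<iota> 1 = 1 \<and> (\<forall>x\<in>Z. \<forall>y\<in>Z. \<iota> (x + y) = \<iota> x + \<iota> y \<and> \<iota> (x * y) = \<iota> x * \<iota> y) \<and>
     (\<forall>z\<in>Z. \<iota> z * u = u * \<iota> (S z)) \<and>
     u ^ n = rat_scale \<sigma> 1 \<and>
     (\<forall>a. \<exists>!f. f \<in> {..<n} \<rightarrow>\<^sub>E Z \<and> a = (\<Sum>i<n. u ^ i * \<iota> (f i)))"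


section \<open>Splitting at a rational prime\<close>

subsection \<open>The field of \<open>q\<close>-adic numbers\<close>

definition padic_abs :: "nat \<Rightarrow> rat \<Rightarrow> real" where
  "padic_abs q x = (if x = 0 then 0 else
     real q powi (int (multiplicity (int q) (snd (quotient_of x)))
                - int (multiplicity (int q) (fst (quotient_of x)))))"

definition padic_cauchy_ring :: "nat \<Rightarrow> (nat \<Rightarrow> rat) ring" where
  "padic_cauchy_ring q =
     \<lparr>carrier = {x. \<forall>e>0. \<exists>N. \<forall>i\<ge>N. \<forall>j\<ge>N. padic_abs q (x i - x j) < e},
      mult = \<lambda>x y i. x i * y i, one = \<lambda>i. 1, zero = \<lambda>i. 0, add = \<lambda>x y i. x i + y i\<rparr>"

definition padic_null :: "nat \<Rightarrow> (nat \<Rightarrow> rat) set" where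
  "padic_null q = {x. (\<lambda>i. padic_abs q (x i)) \<longlonglongrightarrow> 0}"

definition padic_field :: "nat \<Rightarrow> (nat \<Rightarrow> rat) set ring" where
  "padic_field q = padic_cauchy_ring q Quot padic_null q"

definition padic_of_rat :: "nat \<Rightarrow> rat \<Rightarrow> (nat \<Rightarrow> rat) set" where
  "padic_of_rat q c = padic_null q +>\<^bsub>padic_cauchy_ring q\<^esub> (\<lambda>i. c)"

subsection \<open>Extension of scalars and splitting\<close>

text \<open>
  Given a finite \<open>\<rat>\<close>-basis \<open>B\<close> of \<open>A\<close> and a ring homomorphism \<open>\<phi>\<close> from \<open>\<rat>\<close> to a field \<open>K\<close>, the
  \<open>K\<close>-algebra \<open>A \<otimes> K\<close> is the \<open>K\<close>-vector space of coordinate functions on \<open>B\<close>, multiplied by means of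
  the structure constants of \<open>A\<close> with respect to \<open>B\<close>.
\<close>

definition scalar_extension ::
  "('k, 'm) ring_scheme \<Rightarrow> (rat \<Rightarrow> 'k) \<Rightarrow> 'a :: {division_ring, ring_char_0} set \<Rightarrow> ('a \<Rightarrow> 'k) ring" where
  "scalar_extension K \<phi> B =
     \<lparr>carrier = B \<rightarrow>\<^sub>E carrier K,
      mult = \<lambda>f g. \<lambda>d\<in>B. \<Oplus>\<^bsub>K\<^esub>b\<in>B. \<Oplus>\<^bsub>K\<^esub>c\<in>B.
        f b \<otimes>\<^bsub>K\<^esub> g c \<otimes>\<^bsub>K\<^esub> \<phi> (rat_vs.representation B (b * c) d),
      one = \<lambda>d\<in>B. \<phi> (rat_vs.representation B 1 d),
      zero = \<lambda>d\<in>B. \<zero>\<^bsub>K\<^esub>,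
      add = \<lambda>f g. \<lambda>d\<in>B. f d \<oplus>\<^bsub>K\<^esub> g d\<rparr>"

definition matrix_algebra :: "('k, 'm) ring_scheme \<Rightarrow> nat \<Rightarrow> (nat \<times> nat \<Rightarrow> 'k) ring" where
  "matrix_algebra K n = (let I = {..<n} \<times> {..<n} in
     \<lparr>carrier = I \<rightarrow>\<^sub>E carrier K,
      mult = \<lambda>M N. \<lambda>(i, j)\<in>I. \<Oplus>\<^bsub>K\<^esub>k\<in>{..<n}. M (i, k) \<otimes>\<^bsub>K\<^esub> N (k, j),
      one = \<lambda>(i, j)\<in>I. if i = j then \<one>\<^bsub>K\<^esub> else \<zero>\<^bsub>K\<^esub>,
      zero = \<lambda>(i, j)\<in>I. \<zero>\<^bsub>K\<^esub>,
      add = \<lambda>M N. \<lambda>(i, j)\<in>I. M (i, j) \<oplus>\<^bsub>K\<^esub> N (i, j)\<rparr>)"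

text \<open>
  \<open>A\<close>, of degree \<open>n\<close>, splits at \<open>q\<close> if \<open>A \<otimes> \<rat>\<^sub>q\<close> and \<open>M\<^sub>n(\<rat>\<^sub>q)\<close> are isomorphic as
  \<open>\<rat>\<^sub>q\<close>-algebras. The choice of the basis \<open>B\<close> is immaterial.
\<close>

definition splits_at :: "'a :: {division_ring, ring_char_0} itself \<Rightarrow> nat \<Rightarrow> nat \<Rightarrow> bool" where
  "splits_at _ n q \<longleftrightarrow> (\<exists>(B :: 'a set) h.
     finite B \<and> rat_vs.independent B \<and> rat_vs.span B = UNIV \<and>
     h \<in> ring_iso (scalar_extension (padic_field q) (padic_of_rat q) B) (matrix_algebra (padic_field q) n) \<and>
     (\<forall>c\<in>carrier (padic_field q). \<forall>f\<in>B \<rightarrow>\<^sub>E carrier (padic_field q).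
        h (\<lambda>b\<in>B. c \<otimes>\<^bsub>padic_field q\<^esub> f b) =
        (\<lambda>ij\<in>{..<n} \<times> {..<n}. c \<otimes>\<^bsub>padic_field q\<^esub> h f ij)))"

definition nonsplit_primes :: "'a :: {division_ring, ring_char_0} itself \<Rightarrow> nat \<Rightarrow> nat set" where
  "nonsplit_primes A n = {q. prime q \<and> \<not> splits_at A n q}"


section \<open>Canonical generations and associated maximal orders\<close>

definition canonical_generation ::
  "nat \<Rightarrow> int \<Rightarrow> complex set \<Rightarrow> (complex \<Rightarrow> complex) \<Rightarrow>
   (complex \<Rightarrow> 'a :: {division_ring, ring_char_0}) \<Rightarrow> 'a \<Rightarrow> nat \<Rightarrow> bool" where
  "canonical_generation n \<sigma> Z S \<iota> u p \<longleftrightarrow>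
     prime n \<and> odd n \<and> cyclic_generation n (of_int \<sigma>) Z S \<iota> u \<and>
     finite (nonsplit_primes TYPE('a) n) \<and> card (nonsplit_primes TYPE('a) n) \<ge> 2 \<and>
     \<sigma> = (\<Prod>q\<in>nonsplit_primes TYPE('a) n. int q) \<and>
     prime p \<and> [p = 1] (mod n) \<and> \<not> int p dvd \<sigma> \<and>
     (\<forall>q\<in>nonsplit_primes TYPE('a) n. \<not> (\<exists>x. [x ^ n = int q] (mod int p))) \<and>
     (\<exists>x. [x ^ n = \<sigma>] (mod int p)) \<and>
     has_conductor Z p"

definition gauss_period :: "nat \<Rightarrow> nat \<Rightarrow> nat \<Rightarrow> complex \<Rightarrow> complex" where
  "gauss_period n h g \<xi> = (\<Sum>r<h. \<xi> ^ (g ^ (n * r)))"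

definition period_beta :: "nat \<Rightarrow> nat \<Rightarrow> nat \<Rightarrow> complex \<Rightarrow> complex" where
  "period_beta n h g \<xi> = (\<Prod>r<h. 1 - \<xi> ^ (g ^ (n * r)))"

definition order_I ::
  "nat \<Rightarrow> (complex \<Rightarrow> complex) \<Rightarrow> (complex \<Rightarrow> 'a :: {division_ring, ring_char_0}) \<Rightarrow> complex \<Rightarrow> 'a \<Rightarrow> 'a set" where
  "order_I n S \<iota> \<eta> y = {\<Sum>i<n. \<Sum>k<n. of_int (c i k) * (y ^ i * \<iota> ((S ^^ k) \<eta>)) | c. True}"

text \<open>
  That \<open>order_I\<close> yields a maximal order is a theorem of Hull, so it is not part of the definition.
\<close>

definition associated_maximal_order ::
  "nat \<Rightarrow> int \<Rightarrow> (complex \<Rightarrow> complex) \<Rightarrow>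
   (complex \<Rightarrow> 'a :: {division_ring, ring_char_0}) \<Rightarrow> 'a \<Rightarrow> nat \<Rightarrow> 'a set \<Rightarrow> bool" where
  "associated_maximal_order n \<sigma> S \<iota> u p \<mm> \<longleftrightarrow> (\<exists>h g \<xi> l y.
     p = h * n + 1 \<and> residue_primroot p g \<and>
     \<xi> ^ p = 1 \<and> (\<forall>k. 0 < k \<and> k < p \<longrightarrow> \<xi> ^ k \<noteq> 1) \<and>
     [l ^ n = \<sigma>] (mod int p) \<and>
     of_nat p * y = (of_int l - u) * \<iota> (period_beta n h g \<xi> ^ (n - 1)) \<and>
     \<mm> = order_I n S \<iota> (gauss_period n h g \<xi>) y)"


section \<open>Matrices over a subset of a ring\<close>

definition matrices_over :: "nat \<Rightarrow> 'a set \<Rightarrow> 'a mat set" where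
  "matrices_over r R = {C \<in> carrier_mat r r. elements_mat C \<subseteq> R}"

definition sum_of_squares_in :: "nat \<Rightarrow> 'a :: semiring_0 mat set \<Rightarrow> 'a mat \<Rightarrow> bool" where
  "sum_of_squares_in r M C \<longleftrightarrow>
     (\<exists>Xs. set Xs \<subseteq> M \<and> C = foldr (+) (map (\<lambda>X. X * X) Xs) (0\<^sub>m r r))"

end

theory Submission
  imports Defs "Jordan_Normal_Form.Char_Poly" "HOL-Computational_Algebra.Field_as_Ring"
begin

text \<open>
  For \<open>r \<ge> 2\<close> and an additive group \<open>\<mm>\<close> containing \<open>1\<close>, every matrix over \<open>\<mm>\<close> with zero diagonal and
  every \<open>diag(x, - x)\<close> and \<open>diag(2x, 0)\<close> is a sum of squares, so the question is which \<open>x\<close> make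
  \<open>diag(x, 0)\<close> one. These \<open>x\<close> include \<open>2\<mm>\<close> and all squares from \<open>\<mm>\<close>; it remains to see that
  \<open>\<mm>\<close> is generated additively by squares modulo \<open>2\<mm>\<close>.

  Let \<open>R\<close> be the ring spanned over \<open>\<int>\<close> by the Gaussian periods and \<open>L = R + uR + u\<^sup>2R\<close>. As
  \<open>N(\<beta>) = p\<close>, we have \<open>p\<^sup>6 L \<subseteq> \<mm>\<close> and \<open>p\<^sup>2 \<mm> \<subseteq> L\<close> with \<open>p\<close> odd, so it suffices to treat \<open>L\<close>;
  since the squares are taken inside \<open>p\<^sup>6 L\<close>, Hull's theorem that \<open>\<mm>\<close> is a ring is not needed.
  Anticommutators \<open>xy + yx = (x + y)\<^sup>2 - x\<^sup>2 - y\<^sup>2\<close> of suitable monomials give \<open>u(z + z\<^sup>S)\<close>,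
  \<open>u\<^sup>2(z + z\<^sup>S\<^sup>S)\<close> and \<open>\<sigma>(z + z\<^sup>S\<^sup>S)\<close>, and \<open>1\<close>, \<open>u\<^sup>2\<close>, \<open>u\<^sup>4 = \<sigma>u\<close> are squares. With \<open>\<sigma>\<close> odd this is
  everything, because traces of elements of \<open>R\<close> are integers.

  That \<open>Z\<close> really contains the periods follows from its conductor: \<open>Z \<subseteq> \<rat>(\<xi>)\<close>, and an
  automorphism \<open>\<xi> \<mapsto> \<xi>\<^sup>g\<close> restricts to a power of \<open>S\<close> on \<open>Z\<close>, so its cube fixes \<open>Z\<close> pointwise.
\<close>

section \<open>Sums of squares of matrices\<close>

lemma sum_of_squares_in_0: "sum_of_squares_in r M (0\<^sub>m r r)"
  unfolding sum_of_squares_in_def by (rule exI[of _ "[]"]) simp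

lemma foldr_squares_carrier:
  assumes "M \<subseteq> carrier_mat r r" "set Xs \<subseteq> M"
  shows "foldr (+) (map (\<lambda>X. X * X) Xs) (0\<^sub>m r r) \<in> carrier_mat r r"
  using assms(2)
proof (induction Xs)
  case (Cons X Xs)
  then have "X \<in> carrier_mat r r" using assms(1) by auto
  with Cons show ?case by auto
qed simp

lemma foldr_squares_append:
  fixes M :: "'a :: semiring_0 mat set"
  assumes "M \<subseteq> carrier_mat r r" "set Xs \<subseteq> M" "set Ys \<subseteq> M"
  shows "foldr (+) (map (\<lambda>X. X * X) (Xs @ Ys)) (0\<^sub>m r r) =
    foldr (+) (map (\<lambda>X. X * X) Xs) (0\<^sub>m r r) + foldr (+) (map (\<lambda>X. X * X) Ys) (0\<^sub>m r r)"
  using assms(2)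
proof (induction Xs)
  case Nil
  show ?case using foldr_squares_carrier[OF assms(1,3)] by simp
next
  case (Cons X Xs)
  then have X: "X * X \<in> carrier_mat r r" using assms(1) by auto
  show ?case
    using Cons assoc_add_mat[OF X foldr_squares_carrier[OF assms(1), of Xs] foldr_squares_carrier[OF assms(1,3)]]
    by simp
qed

lemma sum_of_squares_in_add:
  assumes "M \<subseteq> carrier_mat r r" "sum_of_squares_in r M A" "sum_of_squares_in r M B"
  shows "sum_of_squares_in r M (A + B)"
proof -
  obtain Xs Ys where Xs: "set Xs \<subseteq> M" "A = foldr (+) (map (\<lambda>X. X * X) Xs) (0\<^sub>m r r)"
    and Ys: "set Ys \<subseteq> M" "B = foldr (+) (map (\<lambda>X. X * X) Ys) (0\<^sub>m r r)"
    using assms(2,3) unfolding sum_of_squares_in_def by blast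
  have "A + B = foldr (+) (map (\<lambda>X. X * X) (Xs @ Ys)) (0\<^sub>m r r)"
    unfolding Xs(2) Ys(2) by (rule foldr_squares_append[OF assms(1) Xs(1) Ys(1), symmetric])
  moreover have "set (Xs @ Ys) \<subseteq> M"
    using Xs(1) Ys(1) by simp
  ultimately show ?thesis
    unfolding sum_of_squares_in_def by blast
qed

lemma sum_of_squares_in_square:
  assumes "M \<subseteq> carrier_mat r r" "X \<in> M"
  shows "sum_of_squares_in r M (X * X)"
proof -
  have "X * X \<in> carrier_mat r r"
    using assms by auto
  then show ?thesis
    unfolding sum_of_squares_in_def using assms(2) by (intro exI[of _ "[X]"]) simp
qed

section \<open>Scaled matrix units \<open>x E_ij\<close> and their products\<close>

definition entry_mat :: "nat \<Rightarrow> nat \<Rightarrow> nat \<Rightarrow> 'a \<Rightarrow> 'a :: zero mat" where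
  "entry_mat r i j x = mat r r (\<lambda>ab. if ab = (i, j) then x else 0)"

lemma entry_mat_carrier [simp]: "entry_mat r i j x \<in> carrier_mat r r"
  and entry_mat_index: "a < r \<Longrightarrow> b < r \<Longrightarrow> entry_mat r i j x $$ (a, b) = (if a = i \<and> b = j then x else 0)"
  and entry_mat_dim [simp]: "dim_row (entry_mat r i j x) = r" "dim_col (entry_mat r i j x) = r"
  by (auto simp: entry_mat_def)

lemma entry_mat_mult:
  fixes x y :: "'a :: semiring_0"
  assumes "i < r" "j < r" "l < r"
  shows "entry_mat r i j x * entry_mat r k l y = (if j = k then entry_mat r i l (x * y) else 0\<^sub>m r r)"
proof (rule eq_matI)
  fix a b assume "a < dim_row (if j = k then entry_mat r i l (x * y) else 0\<^sub>m r r)"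
    "b < dim_col (if j = k then entry_mat r i l (x * y) else 0\<^sub>m r r)"
  then have ab: "a < r" "b < r"
    by (auto split: if_splits)
  have "(entry_mat r i j x * entry_mat r k l y) $$ (a, b) =
      (\<Sum>c = 0..<r. entry_mat r i j x $$ (a, c) * entry_mat r k l y $$ (c, b))"
    using ab by (simp add: scalar_prod_def)
  also have "\<dots> = (\<Sum>c = 0..<r. if c = j then (if a = i \<and> j = k \<and> b = l then x * y else 0) else 0)"
    using ab by (intro sum.cong) (auto simp: entry_mat_index)
  also have "\<dots> = (if a = i \<and> j = k \<and> b = l then x * y else 0)"
    using assms by simp
  also have "\<dots> = (if j = k then entry_mat r i l (x * y) else 0\<^sub>m r r) $$ (a, b)"
    using ab by (simp add: entry_mat_index)
  finally show "(entry_mat r i j x * entry_mat r k l y) $$ (a, b) =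
    (if j = k then entry_mat r i l (x * y) else 0\<^sub>m r r) $$ (a, b)" .
qed auto

lemma add_mat_square:
  fixes A B :: "'a :: semiring_0 mat"
  assumes "A \<in> carrier_mat r r" "B \<in> carrier_mat r r"
  shows "(A + B) * (A + B) = (A * A + A * B) + (B * A + B * B)"
proof -
  have "(A + B) * (A + B) = A * (A + B) + B * (A + B)"
    using assms by (intro add_mult_distrib_mat[of _ r r]) auto
  then show ?thesis
    using assms by (simp add: mult_add_distrib_mat[of _ r r _ r])
qed

text \<open>Subtraction alone yields 0, negatives and sums. Only the matrices that get squared must
  have entries in \<open>R\<close>; the squares themselves may leave it.\<close>

locale matrix_squares =
  fixes R :: "'a :: ring_1 set" and r :: nat
  assumes one_in: "1 \<in> R" and diff_in: "a \<in> R \<Longrightarrow> b \<in> R \<Longrightarrow> a - b \<in> R" and r_ge_2: "r \<ge> 2"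
begin

lemma zero_in: "0 \<in> R"
  using diff_in[OF one_in one_in] by simp

lemma uminus_in: "a \<in> R \<Longrightarrow> - a \<in> R"
  using diff_in[OF zero_in] by simp

lemma add_in: "a \<in> R \<Longrightarrow> b \<in> R \<Longrightarrow> a + b \<in> R"
  using diff_in[OF _ uminus_in] by simp

abbreviation MR :: "'a mat set" where "MR \<equiv> matrices_over r R"

abbreviation SS :: "'a mat \<Rightarrow> bool" where "SS \<equiv> sum_of_squares_in r MR"

lemma MR_carrier: "MR \<subseteq> carrier_mat r r"
  by (auto simp: matrices_over_def)

lemma MR_I: "C \<in> carrier_mat r r \<Longrightarrow> (\<And>i j. i < r \<Longrightarrow> j < r \<Longrightarrow> C $$ (i, j) \<in> R) \<Longrightarrow> C \<in> MR"
  by (auto simp: matrices_over_def dest!: elements_matD)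

lemma MR_D: "C \<in> MR \<Longrightarrow> i < r \<Longrightarrow> j < r \<Longrightarrow> C $$ (i, j) \<in> R"
  by (auto simp: matrices_over_def)

lemma entry_MR: "x \<in> R \<Longrightarrow> entry_mat r i j x \<in> MR"
  using zero_in by (intro MR_I) (auto simp: entry_mat_index)

lemma add_MR: "A \<in> MR \<Longrightarrow> B \<in> MR \<Longrightarrow> A + B \<in> MR"
proof -
  assume A: "A \<in> MR" and B: "B \<in> MR"
  then have c: "A \<in> carrier_mat r r" "B \<in> carrier_mat r r"
    using MR_carrier by auto
  show ?thesis
    by (rule MR_I) (use c A B in \<open>auto intro: add_in MR_D\<close>)
qed

lemmas SS_add = sum_of_squares_in_add[OF MR_carrier]
lemmas SS_square = sum_of_squares_in_square[OF MR_carrier]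

text \<open>The quarter turn in the coordinates \<open>i\<close>, \<open>j\<close> has the square
  \<open>- E_ii - E_jj\<close>, and adding the idempotent \<open>E_jj\<close> leaves
  \<open>- E_ii\<close>. From here on, subtracting \<open>E_ii\<close> counts as adding
  squares.\<close>

lemma SS_neg_idempotent:
  assumes "i < r" "j < r" "i \<noteq> j"
  shows "SS (entry_mat r i i (- 1))"
proof -
  let ?J = "entry_mat r i j (- 1) + entry_mat r j i 1 :: 'a mat"
  have "SS (?J * ?J + entry_mat r j j 1 * entry_mat r j j 1)"
    using one_in uminus_in by (intro SS_add SS_square add_MR entry_MR) auto
  also have "?J * ?J + entry_mat r j j 1 * entry_mat r j j 1 = entry_mat r i i (- 1)"
    using assms
    by (simp add: add_mat_square[of _ r] entry_mat_mult) (intro eq_matI, auto simp: entry_mat_index)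
  finally show ?thesis .
qed

text \<open>\<open>E_ii + x E_ij\<close> is idempotent, hence its own square; subtracting
  \<open>E_ii\<close> isolates the off-diagonal entry.\<close>

lemma SS_off_diagonal:
  assumes "i < r" "j < r" "i \<noteq> j" "x \<in> R"
  shows "SS (entry_mat r i j x)"
proof -
  let ?J = "entry_mat r i i 1 + entry_mat r i j x"
  have "SS (?J * ?J + entry_mat r i i (- 1))"
    using one_in assms by (intro SS_add[OF _ SS_neg_idempotent[of i j]] SS_square add_MR entry_MR) auto
  also have "?J * ?J + entry_mat r i i (- 1) = entry_mat r i j x"
    using assms
    by (simp add: add_mat_square[of _ r] entry_mat_mult) (intro eq_matI, auto simp: entry_mat_index)
  finally show ?thesis .
qed

text \<open>The matrix with rows \<open>(1 - x, x)\<close> and \<open>(1 - x, x)\<close> is idempotent.\<close>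

lemma SS_traceless:
  assumes "i < r" "j < r" "i \<noteq> j" "x \<in> R"
  shows "SS (entry_mat r j j x + entry_mat r i i (- x))"
proof -
  let ?A = "entry_mat r i i (1 - x) + entry_mat r i j x"
    and ?B = "entry_mat r j i (1 - x) + entry_mat r j j x"
  let ?J = "?A + ?B"
  have J: "?J * ?J = ?J"
  proof -
    have c: "?A \<in> carrier_mat r r" "?B \<in> carrier_mat r r" by auto
    have AA: "?A * ?A = entry_mat r i i ((1 - x) * (1 - x)) + entry_mat r i j ((1 - x) * x)"
      using assms by (simp add: add_mat_square[of _ r] entry_mat_mult)
    have BB: "?B * ?B = entry_mat r j i (x * (1 - x)) + entry_mat r j j (x * x)"
      using assms by (simp add: add_mat_square[of _ r] entry_mat_mult)
    have AB: "?A * ?B = entry_mat r i i (x * (1 - x)) + entry_mat r i j (x * x)"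
      using assms
      by (simp add: add_mult_distrib_mat[of _ r r _ _ r] mult_add_distrib_mat[of _ r r _ r] entry_mat_mult)
    have BA: "?B * ?A = entry_mat r j i ((1 - x) * (1 - x)) + entry_mat r j j ((1 - x) * x)"
      using assms
      by (simp add: add_mult_distrib_mat[of _ r r _ _ r] mult_add_distrib_mat[of _ r r _ r] entry_mat_mult)
    show ?thesis
      unfolding add_mat_square[OF c] AA BB AB BA
      using assms by (intro eq_matI) (auto simp: entry_mat_index algebra_simps)
  qed
  \<comment> \<open>Removing both off-diagonal entries and \<open>E_ii\<close> from the idempotent
    turns its diagonal \<open>1 - x\<close>, \<open>x\<close> into \<open>- x\<close>,
    \<open>x\<close>.\<close>
  have "SS (?J * ?J + entry_mat r i j (- x) + entry_mat r j i (- (1 - x)) + entry_mat r i i (- 1))"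
    using one_in assms uminus_in[OF assms(4)] diff_in[OF one_in assms(4)] uminus_in[OF diff_in[OF one_in assms(4)]]
    by (intro SS_add[OF _ SS_neg_idempotent[of i j]] SS_add[OF _ SS_off_diagonal] SS_square add_MR entry_MR) auto
  also have "?J * ?J + entry_mat r i j (- x) + entry_mat r j i (- (1 - x)) + entry_mat r i i (- 1) =
      entry_mat r j j x + entry_mat r i i (- x)"
    unfolding J using assms by (intro eq_matI) (auto simp: entry_mat_index)
  finally show ?thesis .
qed

text \<open>\<open>x E_01 + E_10\<close> has the square \<open>diag(x, x)\<close>; adding the
  traceless \<open>diag(x, - x)\<close> clears the second entry.\<close>

lemma SS_double:
  assumes "x \<in> R"
  shows "SS (entry_mat r 0 0 (x + x))"
proof -
  let ?J = "entry_mat r 0 1 x + entry_mat r 1 0 1"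
  have "SS (?J * ?J + (entry_mat r 0 0 x + entry_mat r 1 1 (- x)))"
    using one_in assms r_ge_2 by (intro SS_add SS_traceless SS_square add_MR entry_MR) auto
  also have "?J * ?J + (entry_mat r 0 0 x + entry_mat r 1 1 (- x)) = entry_mat r 0 0 (x + x)"
    using r_ge_2
    by (simp add: add_mat_square[of _ r] entry_mat_mult) (intro eq_matI, auto simp: entry_mat_index)
  finally show ?thesis .
qed

lemma SS_entry_square:
  assumes "x \<in> R"
  shows "SS (entry_mat r 0 0 (x * x))"
  using SS_square[OF entry_MR[OF assms, of 0 0]] r_ge_2 by (simp add: entry_mat_mult)

lemma SS_entry_add:
  assumes "SS (entry_mat r 0 0 x)" "SS (entry_mat r 0 0 y)"
  shows "SS (entry_mat r 0 0 (x + y))"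
proof -
  have "entry_mat r 0 0 (x + y) = entry_mat r 0 0 x + entry_mat r 0 0 y"
    using r_ge_2 by (intro eq_matI) (auto simp: entry_mat_index)
  then show ?thesis
    using SS_add[OF assms] by simp
qed

text \<open>A diagonal entry moves to the corner along a traceless matrix:
  \<open>x E_ii = (x E_ii - x E_00) + x E_00\<close>.\<close>

lemma SS_if_corner:
  assumes corner: "\<And>x. x \<in> R \<Longrightarrow> SS (entry_mat r 0 0 x)" and C: "C \<in> MR"
  shows "SS C"
proof -
  have entry: "SS (entry_mat r i j x)" if "i < r" "j < r" "x \<in> R" for i j x
  proof (cases "i = j")
    case diag: True
    show ?thesis
    proof (cases "i = 0")
      case True
      then show ?thesis using diag corner that by simp
    next
      case False
      have "SS (entry_mat r i i x + entry_mat r 0 0 (- x) + entry_mat r 0 0 x)"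
        using that False r_ge_2 by (intro SS_add[OF _ corner] SS_traceless) auto
      also have "entry_mat r i i x + entry_mat r 0 0 (- x) + entry_mat r 0 0 x = entry_mat r i j x"
        using diag False by (intro eq_matI) (auto simp: entry_mat_index)
      finally show ?thesis .
    qed
  qed (use that SS_off_diagonal in auto)
  \<comment> \<open>\<open>part P\<close> keeps the entries of \<open>C\<close> at the positions in
    \<open>P\<close>, so that \<open>C\<close> is assembled one position at a time.\<close>
  define part where "part P = mat r r (\<lambda>ij. if ij \<in> P then C $$ ij else 0)" for P
  have "SS (part P)" if "finite P" "P \<subseteq> {..<r} \<times> {..<r}" for P
    using that
  proof (induction P rule: finite_induct)
    case empty
    have "part {} = 0\<^sub>m r r"
      by (intro eq_matI) (auto simp: part_def)
    then show ?case
      using sum_of_squares_in_0[of r MR] by simp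
  next
    case (insert ij P)
    obtain i j where ij: "ij = (i, j)" by force
    have "SS (entry_mat r i j (C $$ (i, j)) + part P)"
      using insert ij by (intro SS_add entry MR_D[OF C]) auto
    also have "entry_mat r i j (C $$ (i, j)) + part P = part (insert ij P)"
      using insert(2) ij by (intro eq_matI) (auto simp: part_def entry_mat_index)
    finally show ?case .
  qed
  from this[of "{..<r} \<times> {..<r}"] have "SS (part ({..<r} \<times> {..<r}))"
    by simp
  also have "part ({..<r} \<times> {..<r}) = C"
    using C MR_carrier by (intro eq_matI) (auto simp: part_def)
  finally show ?thesis .
qed

end

section \<open>Squares in a crossed product of degree three\<close>

lemma of_nat_mult_mult:
  fixes x z :: "'a :: ring_1"
  shows "of_nat m * x * (of_nat n * z) = of_nat m * (of_nat n * (x * z))"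
proof -
  have "x * (of_nat n * z) = x * of_nat n * z"
    by (rule mult.assoc[symmetric])
  also have "x * of_nat n = of_nat n * x"
    by (rule mult_of_nat_commute[symmetric])
  finally show ?thesis
    by (simp add: mult.assoc)
qed

text \<open>In the application \<open>R\<close> is the period ring, \<open>\<alpha>\<close> is the
  square of \<beta>, and \<open>\<gamma>\<close> is the product of the other two conjugates of
  \<open>\<alpha>\<close>. \<open>split1\<close> and \<open>split2\<close> state that
  \<open>1 + S\<close> and \<open>1 + S^2\<close> are surjective on \<open>R\<close> modulo the
  integers.\<close>

locale cubic_crossed_order =
  fixes R :: "complex set" and S :: "complex \<Rightarrow> complex" and \<iota> :: "complex \<Rightarrow> 'a :: ring_1"
    and u y :: 'a and \<sigma> l :: int and p :: nat and \<alpha> \<gamma> :: complex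
  assumes R_1: "1 \<in> R"
    and R_diff: "a \<in> R \<Longrightarrow> b \<in> R \<Longrightarrow> a - b \<in> R"
    and R_mult: "a \<in> R \<Longrightarrow> b \<in> R \<Longrightarrow> a * b \<in> R"
    and S_in: "a \<in> R \<Longrightarrow> S a \<in> R"
    and S_1: "S 1 = 1"
    and S_add: "a \<in> R \<Longrightarrow> b \<in> R \<Longrightarrow> S (a + b) = S a + S b"
    and S_mult: "a \<in> R \<Longrightarrow> b \<in> R \<Longrightarrow> S (a * b) = S a * S b"
    and \<iota>_1: "\<iota> 1 = 1"
    and \<iota>_add: "a \<in> R \<Longrightarrow> b \<in> R \<Longrightarrow> \<iota> (a + b) = \<iota> a + \<iota> b"
    and \<iota>_mult: "a \<in> R \<Longrightarrow> b \<in> R \<Longrightarrow> \<iota> (a * b) = \<iota> a * \<iota> b"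
    and \<iota>_u: "a \<in> R \<Longrightarrow> \<iota> a * u = u * \<iota> (S a)"
    and u_cube: "u * (u * u) = of_int \<sigma>"
    and odd_\<sigma>: "odd \<sigma>" and odd_p: "odd p"
    and split1: "a \<in> R \<Longrightarrow> \<exists>n w. w \<in> R \<and> a = of_int n + w + S w"
    and split2: "a \<in> R \<Longrightarrow> \<exists>n w. w \<in> R \<and> a = of_int n + w + S (S w)"
    and \<alpha>_in: "\<alpha> \<in> R" and \<gamma>_in: "\<gamma> \<in> R" and \<alpha>_\<gamma>: "\<alpha> * \<gamma> = of_nat p ^ 2"
    and y_def: "of_nat p * y = (of_int l - u) * \<iota> \<alpha>"
begin

lemma R_0: "0 \<in> R"
  using R_diff[OF R_1 R_1] by simp

lemma R_uminus: "a \<in> R \<Longrightarrow> - a \<in> R"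
  using R_diff[OF R_0] by simp

lemma R_add: "a \<in> R \<Longrightarrow> b \<in> R \<Longrightarrow> a + b \<in> R"
  using R_diff[OF _ R_uminus] by simp

lemma R_of_nat: "of_nat n \<in> R"
  by (induction n) (auto simp: R_0 R_1 R_add)

lemma R_of_int: "of_int n \<in> R"
  by (cases n) (simp_all only: of_int_of_nat_eq of_int_minus R_of_nat R_uminus)

lemma R_power: "a \<in> R \<Longrightarrow> a ^ n \<in> R"
  by (induction n) (auto simp: R_1 R_mult)

lemmas R_intros = R_0 R_1 R_uminus R_add R_diff R_mult R_of_nat R_of_int R_power S_in

lemma S_0: "S 0 = 0"
  using S_add[OF R_0 R_0] by simp

lemma S_uminus: "a \<in> R \<Longrightarrow> S (- a) = - S a"
  using S_add[of a "- a"] by (simp add: R_uminus S_0 eq_neg_iff_add_eq_0 add.commute)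

lemma S_of_nat: "S (of_nat n) = of_nat n"
  by (induction n) (auto simp: S_0 S_1 S_add R_intros)

lemma S_of_int: "S (of_int n) = of_int n"
  by (cases n) (simp_all only: of_int_of_nat_eq of_int_minus S_of_nat S_uminus R_of_nat)

lemma \<iota>_0: "\<iota> 0 = 0"
  using \<iota>_add[OF R_0 R_0] by simp

lemma \<iota>_uminus: "a \<in> R \<Longrightarrow> \<iota> (- a) = - \<iota> a"
  using \<iota>_add[of a "- a"] by (simp add: R_uminus \<iota>_0 eq_neg_iff_add_eq_0 add.commute)

lemma \<iota>_of_nat: "\<iota> (of_nat n) = of_nat n"
  by (induction n) (auto simp: \<iota>_0 \<iota>_1 \<iota>_add R_intros)

lemma \<iota>_of_int: "\<iota> (of_int n) = of_int n"
  by (cases n) (simp_all only: of_int_of_nat_eq of_int_minus \<iota>_of_nat \<iota>_uminus R_of_nat)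

lemma \<iota>_u': "a \<in> R \<Longrightarrow> \<iota> a * (u * x) = u * (\<iota> (S a) * x)"
  by (simp add: \<iota>_u flip: mult.assoc)

lemma \<iota>_mult': "a \<in> R \<Longrightarrow> b \<in> R \<Longrightarrow> \<iota> a * (\<iota> b * x) = \<iota> (a * b) * x"
  by (simp add: \<iota>_mult mult.assoc)

lemma u_cube_\<iota>: "u * (u * u) = \<iota> (of_int \<sigma>)"
  by (simp add: u_cube \<iota>_of_int)

lemma u_cube_\<iota>': "u * (u * (u * x)) = \<iota> (of_int \<sigma>) * x"
  by (metis mult.assoc u_cube_\<iota>)

text \<open>Rewriting with these rules moves all powers of \<open>u\<close> to the left and reduces them below \<open>u\<^sup>3\<close>.\<close>

lemmas crossed_simps = distrib_left distrib_right mult.assoc \<iota>_u \<iota>_u' \<iota>_mult[symmetric] \<iota>_mult'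
  \<iota>_add S_add S_mult S_of_int S_of_nat u_cube_\<iota> u_cube_\<iota>' R_intros

section \<open>The lattice \<open>L\<close> and the order\<close>

definition L :: "'a set" where
  "L = {\<iota> a + u * \<iota> b + u * (u * \<iota> c) | a b c. a \<in> R \<and> b \<in> R \<and> c \<in> R}"

text \<open>This will be identified with \<open>order_I\<close>, whose integer coefficients are
  gathered into one element of \<open>R\<close> for each power of \<open>y\<close>.\<close>

definition order_set :: "'a set" where
  "order_set = {\<iota> a + y * \<iota> b + y * (y * \<iota> c) | a b c. a \<in> R \<and> b \<in> R \<and> c \<in> R}"

lemma L_I: "a \<in> R \<Longrightarrow> b \<in> R \<Longrightarrow> c \<in> R \<Longrightarrow> \<iota> a + u * \<iota> b + u * (u * \<iota> c) \<in> L"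
  by (auto simp: L_def)

lemma L_E:
  assumes "x \<in> L"
  obtains a b c where "a \<in> R" "b \<in> R" "c \<in> R" "x = \<iota> a + u * \<iota> b + u * (u * \<iota> c)"
  using assms by (auto simp: L_def)

lemma L_add: 
  assumes "x \<in> L" "x' \<in> L"
  shows "x + x' \<in> L"
proof -
  obtain a b c where x: "a \<in> R" "b \<in> R" "c \<in> R" "x = \<iota> a + u * \<iota> b + u * (u * \<iota> c)"
    using L_E[OF assms(1)] .
  obtain a' b' c' where x': "a' \<in> R" "b' \<in> R" "c' \<in> R" "x' = \<iota> a' + u * \<iota> b' + u * (u * \<iota> c')"
    using L_E[OF assms(2)] .
  have "x + x' = \<iota> (a + a') + u * \<iota> (b + b') + u * (u * \<iota> (c + c'))"
    using x x' by (simp add: \<iota>_add algebra_simps)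
  then show ?thesis
    using x x' by (auto intro!: L_I R_intros)
qed

text \<open>Moving \<open>u\<close> to the left past \<open>\<iota> b\<close> replaces
  \<open>b\<close> by \<open>S b\<close>, and \<open>u^3 = \<sigma>\<close> reduces the degrees 3
  and 4 in \<open>u\<close>.\<close>

lemma L_mult:
  assumes "x \<in> L" "x' \<in> L"
  shows "x * x' \<in> L"
proof -
  obtain a b c where x: "a \<in> R" "b \<in> R" "c \<in> R" "x = \<iota> a + u * \<iota> b + u * (u * \<iota> c)"
    using L_E[OF assms(1)] .
  obtain a' b' c' where x': "a' \<in> R" "b' \<in> R" "c' \<in> R" "x' = \<iota> a' + u * \<iota> b' + u * (u * \<iota> c')"
    using L_E[OF assms(2)] .
  let ?s = "of_int \<sigma> :: complex"
  have "x * x' = \<iota> (a * a' + ?s * (S (S b) * c' + S c * b')) + u * \<iota> (S a * b' + b * a' + ?s * (S (S c) * c')) +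
     u * (u * \<iota> (S (S a) * c' + S b * b' + c * a'))"
    unfolding x(4) x'(4) using x(1-3) x'(1-3) by (simp add: crossed_simps add_ac)
  then show ?thesis
    using x x' by (auto intro!: L_I R_intros)
qed

lemma L_\<iota>: "a \<in> R \<Longrightarrow> \<iota> a \<in> L"
  using L_I[of a 0 0] by (simp add: R_0 \<iota>_0)

lemma L_u: "u \<in> L"
  using L_I[of 0 1 0] by (simp add: R_0 R_1 \<iota>_0 \<iota>_1)

lemma L_of_int: "of_int n \<in> L"
  using L_\<iota>[OF R_of_int] by (simp add: \<iota>_of_int)

lemma L_of_nat: "of_nat n \<in> L"
  using L_of_int[of "int n"] by simp

lemma L_uminus: "x \<in> L \<Longrightarrow> - x \<in> L"
  using L_mult[OF L_of_int[of "- 1"]] by simp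

lemma L_diff: "x \<in> L \<Longrightarrow> x' \<in> L \<Longrightarrow> x - x' \<in> L"
  using L_add[OF _ L_uminus] by simp

lemma order_E:
  assumes "x \<in> order_set"
  obtains a b c where "a \<in> R" "b \<in> R" "c \<in> R" "x = \<iota> a + y * \<iota> b + y * (y * \<iota> c)"
  using assms by (auto simp: order_set_def)

lemma order_add: 
  assumes "x \<in> order_set" "x' \<in> order_set"
  shows "x + x' \<in> order_set"
proof -
  obtain a b c where x: "a \<in> R" "b \<in> R" "c \<in> R" "x = \<iota> a + y * \<iota> b + y * (y * \<iota> c)"
    using order_E[OF assms(1)] .
  obtain a' b' c' where x': "a' \<in> R" "b' \<in> R" "c' \<in> R" "x' = \<iota> a' + y * \<iota> b' + y * (y * \<iota> c')"
    using order_E[OF assms(2)] .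
  have "x + x' = \<iota> (a + a') + y * \<iota> (b + b') + y * (y * \<iota> (c + c'))"
    using x x' by (simp add: \<iota>_add algebra_simps)
  then show ?thesis
    using x x' R_add unfolding order_set_def by blast
qed

lemma order_uminus: 
  assumes "x \<in> order_set"
  shows "- x \<in> order_set"
proof -
  obtain a b c where x: "a \<in> R" "b \<in> R" "c \<in> R" "x = \<iota> a + y * \<iota> b + y * (y * \<iota> c)"
    using order_E[OF assms(1)] .
  have "- x = \<iota> (- a) + y * \<iota> (- b) + y * (y * \<iota> (- c))"
    using x by (simp add: \<iota>_uminus)
  then show ?thesis
    using x R_uminus unfolding order_set_def by blast
qed

lemma order_diff: "x \<in> order_set \<Longrightarrow> x' \<in> order_set \<Longrightarrow> x - x' \<in> order_set"
  using order_add[OF _ order_uminus] by simp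

lemma order_mono0: "a \<in> R \<Longrightarrow> \<iota> a \<in> order_set"
  and order_mono1: "a \<in> R \<Longrightarrow> y * \<iota> a \<in> order_set"
  and order_mono2: "a \<in> R \<Longrightarrow> y * (y * \<iota> a) \<in> order_set"
proof -
  assume a: "a \<in> R"
  have "\<iota> a = \<iota> a + y * \<iota> 0 + y * (y * \<iota> 0)"
    "y * \<iota> a = \<iota> 0 + y * \<iota> a + y * (y * \<iota> 0)"
    "y * (y * \<iota> a) = \<iota> 0 + y * \<iota> 0 + y * (y * \<iota> a)"
    by (simp_all add: \<iota>_0)
  then show "\<iota> a \<in> order_set" "y * \<iota> a \<in> order_set" "y * (y * \<iota> a) \<in> order_set"
    using a R_0 unfolding order_set_def by blast+
qed

lemma order_1: "1 \<in> order_set"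
  using order_mono0[OF R_1] by (simp add: \<iota>_1)

section \<open>Comparison of \<open>L\<close> with the order up to powers of
  \<open>p\<close>\<close>

lemma order_of_nat_mult: "x \<in> order_set \<Longrightarrow> of_nat n * x \<in> order_set"
proof (induction n)
  case 0
  show ?case using order_mono0[OF R_0] by (simp add: \<iota>_0)
qed (auto simp: distrib_right intro: order_add)

text \<open>The definition of \<open>y\<close> gives \<open>u \<alpha> = l \<alpha> - p y\<close>;
  multiplying by \<open>\<gamma>\<close> on the right turns \<open>\<alpha>\<close> into
  \<open>p^2\<close>.\<close>

lemma u_\<iota>_in_order:
  assumes "a \<in> R"
  shows "u * \<iota> (of_nat p ^ 2 * a) \<in> order_set"
proof -
  have "u * \<iota> \<alpha> = of_int l * \<iota> \<alpha> - of_nat p * y"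
    by (simp add: y_def left_diff_distrib)
  then have "u * \<iota> \<alpha> * \<iota> (\<gamma> * a) = \<iota> (of_int l) * \<iota> \<alpha> * \<iota> (\<gamma> * a) - of_nat p * (y * \<iota> (\<gamma> * a))"
    by (simp add: left_diff_distrib mult.assoc \<iota>_of_int)
  moreover have "u * \<iota> \<alpha> * \<iota> (\<gamma> * a) = u * \<iota> (of_nat p ^ 2 * a)"
    using assms by (simp add: mult.assoc R_intros \<alpha>_in \<gamma>_in flip: \<iota>_mult \<alpha>_\<gamma>)
  moreover have "\<iota> (of_int l) * \<iota> \<alpha> * \<iota> (\<gamma> * a) \<in> order_set"
    using assms by (simp add: R_intros \<alpha>_in \<gamma>_in order_mono0 flip: \<iota>_mult)
  ultimately show ?thesis
    using order_diff order_of_nat_mult order_mono1 assms R_mult \<gamma>_in by simp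
qed

text \<open>The square of \<open>p y = \<iota> (l \<alpha>) - u \<iota> \<alpha>\<close>, with all
  \<open>u\<close> moved to the left; \<open>a\<close> and \<open>b\<close> name the two
  coefficients.\<close>

lemma y_square:
  "of_nat p * (of_nat p * (y * y)) =
    \<iota> (of_int l * of_int l * \<alpha> * \<alpha>) - u * \<iota> (of_int l * (S \<alpha> * \<alpha> + \<alpha> * \<alpha>)) + u * (u * \<iota> (S \<alpha> * \<alpha>))"
proof -
  define a b where "a = of_int l * \<alpha>" and "b = - \<alpha>"
  have a: "a \<in> R" "S a = of_int l * S \<alpha>" and b: "b \<in> R" "S b = - S \<alpha>"
    using \<alpha>_in by (simp_all add: a_def b_def R_intros S_mult S_of_int S_uminus)
  have "of_nat p * (of_nat p * (y * y)) = (of_nat p * y) * (of_nat p * y)"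
    by (simp add: of_nat_mult_mult)
  also have "of_nat p * y = \<iota> a + u * \<iota> b"
    using \<alpha>_in by (simp add: y_def a_def b_def \<iota>_uminus \<iota>_mult R_intros \<iota>_of_int left_diff_distrib)
  also have "(\<iota> a + u * \<iota> b) * (\<iota> a + u * \<iota> b) = \<iota> (a * a) + u * \<iota> (S a * b + b * a) + u * (u * \<iota> (S b * b))"
    using a(1) b(1) by (simp add: crossed_simps add_ac)
  also have "S a * b + b * a = - (of_int l * (S \<alpha> * \<alpha> + \<alpha> * \<alpha>))"
    unfolding a(2) b(2) by (simp add: a_def b_def algebra_simps)
  also have "S b * b = S \<alpha> * \<alpha>"
    unfolding b(2) by (simp add: b_def)
  also have "a * a = of_int l * of_int l * \<alpha> * \<alpha>"
    by (simp add: a_def)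
  finally show ?thesis
    using \<alpha>_in by (simp add: \<iota>_uminus R_intros)
qed

lemma uu_\<iota>_in_order:
  assumes "a \<in> R"
  shows "u * (u * \<iota> (of_nat p ^ 6 * a)) \<in> order_set"
proof -
  define q where "q = (of_nat p ^ 2 :: complex)"
  \<comment> \<open>\<open>S \<gamma> * \<gamma>\<close> turns the leading coefficient
    \<open>S \<alpha> * \<alpha>\<close> of \<open>y_square\<close> into \<open>p^4\<close>. The
    further factor \<open>q = p^2\<close> is the one that \<open>u_\<iota>_in_order\<close> requires
    in the term linear in \<open>u\<close>.\<close>
  define d where "d = S \<gamma> * \<gamma> * q * a"
  have q: "q \<in> R" "S q = q"
    by (simp_all add: q_def R_intros S_of_nat S_mult power2_eq_square)
  have d: "d \<in> R"
    using assms \<gamma>_in q by (simp add: d_def R_intros)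
  have "S \<alpha> * \<alpha> * d = S (\<alpha> * \<gamma>) * (\<alpha> * \<gamma>) * q * a"
    using \<alpha>_in \<gamma>_in by (simp add: d_def S_mult mult_ac)
  also have "\<dots> = of_nat p ^ 6 * a"
    unfolding \<alpha>_\<gamma> q_def[symmetric] q(2) by (simp add: q_def eval_nat_numeral)
  finally have d6: "S \<alpha> * \<alpha> * d = of_nat p ^ 6 * a" .
  have "of_nat p * (of_nat p * (y * (y * \<iota> d))) = of_nat p * (of_nat p * (y * y)) * \<iota> d"
    by (simp add: mult.assoc)
  also have "\<dots> = \<iota> (of_int l * of_int l * \<alpha> * \<alpha> * d) - u * \<iota> (of_int l * (S \<alpha> * \<alpha> + \<alpha> * \<alpha>) * d)
      + u * (u * \<iota> (S \<alpha> * \<alpha> * d))"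
    unfolding y_square using \<alpha>_in d by (simp add: left_diff_distrib distrib_right mult.assoc R_intros flip: \<iota>_mult)
  also have "of_int l * (S \<alpha> * \<alpha> + \<alpha> * \<alpha>) * d = of_nat p ^ 2 * (of_int l * (S \<alpha> * \<alpha> + \<alpha> * \<alpha>) * (S \<gamma> * \<gamma> * a))"
    by (simp add: d_def q_def mult_ac)
  finally have "u * (u * \<iota> (of_nat p ^ 6 * a)) = of_nat p * (of_nat p * (y * (y * \<iota> d)))
    - \<iota> (of_int l * of_int l * \<alpha> * \<alpha> * d) +
    u * \<iota> (of_nat p ^ 2 * (of_int l * (S \<alpha> * \<alpha> + \<alpha> * \<alpha>) * (S \<gamma> * \<gamma> * a)))"
    unfolding d6 by (simp add: algebra_simps)
  also have "\<dots> \<in> order_set"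
    using assms d \<alpha>_in \<gamma>_in
    by (intro order_add order_diff order_of_nat_mult order_mono0 order_mono2 u_\<iota>_in_order)
      (auto intro!: R_intros)
  finally show ?thesis .
qed

lemma p6_L:
  assumes "x \<in> L"
  shows "of_nat (p ^ 6) * x \<in> order_set"
proof -
  obtain a b c where x: "a \<in> R" "b \<in> R" "c \<in> R" "x = \<iota> a + u * \<iota> b + u * (u * \<iota> c)"
    using L_E[OF assms(1)] .
  have "of_nat (p ^ 6) * x = \<iota> (of_nat (p ^ 6)) * x"
    by (simp only: \<iota>_of_nat)
  also have "\<dots> = \<iota> (of_nat (p ^ 6) * a) + u * \<iota> (of_nat (p ^ 6) * b) + u * (u * \<iota> (of_nat (p ^ 6) * c))"
    unfolding x(4) using x(1-3) by (simp add: crossed_simps del: of_nat_power)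
  also have "\<dots> = \<iota> (of_nat (p ^ 6) * a) + u * \<iota> (of_nat p ^ 2 * (of_nat p ^ 4 * b)) + u * (u * \<iota> (of_nat p ^ 6 * c))"
    by (simp flip: mult.assoc power_add)
  also have "\<dots> \<in> order_set"
    using x by (intro order_add order_mono0 u_\<iota>_in_order uu_\<iota>_in_order) (auto intro!: R_intros)
  finally show ?thesis .
qed

text \<open>\<open>p y = (l - u) \<alpha>\<close> lies in the ring \<open>L\<close>, and
  \<open>y\<close> occurs at most twice in a term.\<close>

lemma p2_order:
  assumes "x \<in> order_set"
  shows "of_nat (p ^ 2) * x \<in> L"
proof -
  obtain a b c where x: "a \<in> R" "b \<in> R" "c \<in> R" "x = \<iota> a + y * \<iota> b + y * (y * \<iota> c)"
    using order_E[OF assms(1)] .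
  define v where "v = of_nat p * y"
  have v: "v \<in> L"
    unfolding v_def y_def using \<alpha>_in by (intro L_mult L_diff L_of_int L_u L_\<iota>)
  have "v * (v * \<iota> c) = (of_nat p * y) * (of_nat p * (y * \<iota> c))"
    by (simp add: v_def mult.assoc)
  also have "\<dots> = of_nat p * (of_nat p * (y * (y * \<iota> c)))"
    by (rule of_nat_mult_mult)
  finally have yy: "of_nat p * (of_nat p * (y * (y * \<iota> c))) = v * (v * \<iota> c)" ..
  have "of_nat (p ^ 2) * x = of_nat (p ^ 2) * \<iota> a + of_nat p * (v * \<iota> b) + v * (v * \<iota> c)"
    unfolding x(4) by (simp add: distrib_left power2_eq_square mult.assoc yy) (simp add: v_def mult.assoc)
  also have "\<dots> \<in> L"
    using v x by (intro L_add L_mult L_of_nat L_\<iota>)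
  finally show ?thesis .
qed

text \<open>\<open>T\<close> stands for the set of all \<open>x\<close> whose corner matrix is a sum
  of squares.\<close>

context
  fixes T :: "'a set"
  assumes T_add: "a \<in> T \<Longrightarrow> b \<in> T \<Longrightarrow> a + b \<in> T"
    and T_square: "a \<in> order_set \<Longrightarrow> a * a \<in> T"
    and T_double: "a \<in> order_set \<Longrightarrow> a + a \<in> T"
begin

text \<open>The factor \<open>p\<^sup>1\<^sup>2\<close> is \<open>(p\<^sup>6)\<^sup>2\<close>: squares are taken in \<open>p\<^sup>6 L\<close>, which lies in the order.\<close>

definition Q :: "'a set" where
  "Q = {x \<in> L. of_nat (p ^ 12) * x \<in> T}"

lemma Q_L: "x \<in> Q \<Longrightarrow> x \<in> L"
  by (simp add: Q_def)

lemma Q_add: "x \<in> Q \<Longrightarrow> x' \<in> Q \<Longrightarrow> x + x' \<in> Q"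
  by (simp add: Q_def L_add distrib_left T_add)

lemma p12_L: "x \<in> L \<Longrightarrow> of_nat (p ^ 12) * x \<in> order_set"
  using p6_L[of "of_nat (p ^ 6) * x"] L_mult[OF L_of_nat, of x "p ^ 6"]
  by (simp flip: mult.assoc power_add)

lemma Q_double:
  assumes "x \<in> L"
  shows "x + x \<in> Q"
  using T_double[OF p12_L[OF assms]] assms unfolding Q_def by (simp add: L_add distrib_left)

text \<open>\<open>T\<close> is given as closed under addition; \<open>- x = x + 2 (- x)\<close>
  obtains negatives from doubles.\<close>

lemma Q_uminus:
  assumes "x \<in> Q"
  shows "- x \<in> Q"
  using Q_add[OF assms Q_double[OF L_uminus[OF Q_L[OF assms]]]] by simp

lemma Q_diff: "x \<in> Q \<Longrightarrow> x' \<in> Q \<Longrightarrow> x - x' \<in> Q"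
  using Q_add[OF _ Q_uminus] by simp

lemma Q_of_nat_mult: "x \<in> Q \<Longrightarrow> of_nat n * x \<in> Q"
proof (induction n)
  case 0
  show ?case using Q_diff[OF 0 0] by simp
qed (auto simp: distrib_right intro: Q_add)

lemma Q_of_int_mult: "x \<in> Q \<Longrightarrow> of_int n * x \<in> Q"
  by (cases n) (simp_all only: of_int_of_nat_eq of_int_minus Q_of_nat_mult Q_uminus mult_minus_left)

lemma Q_square:
  assumes "x \<in> L"
  shows "x * x \<in> Q"
proof -
  have "(of_nat (p ^ 6) * x) * (of_nat (p ^ 6) * x) = of_nat (p ^ 6) * (of_nat (p ^ 6) * (x * x))"
    by (rule of_nat_mult_mult)
  also have "\<dots> = of_nat (p ^ 12) * (x * x)"
    by (simp flip: mult.assoc power_add)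
  finally show ?thesis
    using T_square[OF p6_L[OF assms]] L_mult[OF assms assms] by (simp add: Q_def)
qed

lemma Q_anticommutator:
  assumes "x \<in> L" "x' \<in> L"
  shows "x * x' + x' * x \<in> Q"
proof -
  have "(x + x') * (x + x') - x * x - x' * x' \<in> Q"
    using assms by (intro Q_diff Q_square L_add)
  then show ?thesis
    by (simp add: algebra_simps)
qed

text \<open>As \<open>\<sigma>\<close> is odd, \<open>x\<close> and \<open>\<sigma> x\<close> differ
  by a double of an element of \<open>L\<close>.\<close>

lemma Q_\<sigma>_cancel:
  assumes "x \<in> L" "of_int \<sigma> * x \<in> Q"
  shows "x \<in> Q"
proof -
  obtain k where k: "\<sigma> = 2 * k + 1"
    using odd_\<sigma> by (elim oddE)
  have "of_int \<sigma> * x - (of_int k * x + of_int k * x) \<in> Q"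
    using assms by (intro Q_diff Q_double L_mult L_of_int)
  also have "of_int \<sigma> * x - (of_int k * x + of_int k * x) = x"
    unfolding k by (simp add: algebra_simps mult_2)
  finally show ?thesis .
qed

lemma Q_1: "1 \<in> Q"
  using Q_square[OF L_of_int[of 1]] by simp

lemma Q_uu: "u * u \<in> Q"
  by (rule Q_square[OF L_u])

lemma Q_u: "u \<in> Q"
proof (rule Q_\<sigma>_cancel[OF L_u])
  have "(u * u) * (u * u) = of_int \<sigma> * u"
    by (simp add: mult.assoc flip: u_cube)
  then show "of_int \<sigma> * u \<in> Q"
    using Q_square[OF L_mult[OF L_u L_u]] by simp
qed

text \<open>The monomials \<open>u w\<close> and \<open>u^2\<close> have total degree 3 in
  \<open>u\<close>, so their anticommutator is \<open>\<sigma>\<close> times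
  \<open>w + S (S w)\<close>. Then \<open>\<sigma>\<close> is cancelled, and the integer part of
  \<open>split2\<close> is a multiple of the square 1.\<close>

lemma Q_\<iota>:
  assumes "a \<in> R"
  shows "\<iota> a \<in> Q"
proof -
  obtain n w where w: "w \<in> R" "a = of_int n + w + S (S w)"
    using split2[OF assms] by blast
  have "(u * \<iota> w) * (u * u) + (u * u) * (u * \<iota> w) \<in> Q"
    using w by (intro Q_anticommutator L_mult L_u L_\<iota>)
  also have "(u * \<iota> w) * (u * u) + (u * u) * (u * \<iota> w) = of_int \<sigma> * \<iota> (w + S (S w))"
    using w(1) by (simp add: crossed_simps add.commute flip: \<iota>_of_int)
  finally have "of_int \<sigma> * \<iota> (w + S (S w)) \<in> Q" .
  then have "\<iota> (w + S (S w)) \<in> Q"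
    using w(1) by (auto intro!: L_\<iota> R_intros intro: Q_\<sigma>_cancel[rotated])
  then have "of_int n * 1 + \<iota> (w + S (S w)) \<in> Q"
    by (rule Q_add[OF Q_of_int_mult[OF Q_1]])
  then show ?thesis
    using w by (simp add: \<iota>_add R_intros \<iota>_of_int add.assoc)
qed

text \<open>Passing one \<open>u\<close> applies \<open>S\<close> once, hence \<open>split1\<close>;
  passing \<open>u^2\<close>, in the next lemma, applies it twice, hence
  \<open>split2\<close>.\<close>

lemma Q_u_\<iota>:
  assumes "a \<in> R"
  shows "u * \<iota> a \<in> Q"
proof -
  obtain n w where w: "w \<in> R" "a = of_int n + w + S w"
    using split1[OF assms] by blast
  have "\<iota> w * u + u * \<iota> w \<in> Q"
    using w by (intro Q_anticommutator L_u L_\<iota>)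
  then have "of_int n * u + (\<iota> w * u + u * \<iota> w) \<in> Q"
    by (rule Q_add[OF Q_of_int_mult[OF Q_u]])
  also have "of_int n * u + (\<iota> w * u + u * \<iota> w) = u * \<iota> a"
    unfolding w(2) using w(1) by (simp add: crossed_simps add_ac flip: \<iota>_of_int)
  finally show ?thesis .
qed

lemma Q_uu_\<iota>:
  assumes "a \<in> R"
  shows "u * (u * \<iota> a) \<in> Q"
proof -
  obtain n w where w: "w \<in> R" "a = of_int n + w + S (S w)"
    using split2[OF assms] by blast
  have "\<iota> w * (u * u) + (u * u) * \<iota> w \<in> Q"
    using w by (intro Q_anticommutator L_mult L_u L_\<iota>)
  then have "of_int n * (u * u) + (\<iota> w * (u * u) + (u * u) * \<iota> w) \<in> Q"
    by (rule Q_add[OF Q_of_int_mult[OF Q_uu]])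
  also have "of_int n * (u * u) + (\<iota> w * (u * u) + (u * u) * \<iota> w) = u * (u * \<iota> a)"
    unfolding w(2) using w(1) by (simp add: crossed_simps add_ac flip: \<iota>_of_int)
  finally show ?thesis .
qed

lemma L_subset_Q: "L \<subseteq> Q"
  by (auto simp: L_def intro!: Q_add Q_\<iota> Q_u_\<iota> Q_uu_\<iota>)

theorem order_subset: "order_set \<subseteq> T"
proof
  fix x assume x: "x \<in> order_set"
  \<comment> \<open>The exponent is 2 + 12: \<open>p^2\<close> moves \<open>x\<close> into
    \<open>L\<close>, and \<open>p^12\<close> is the factor in \<open>Q\<close>. As
    \<open>p^14\<close> is odd, \<open>x\<close> and \<open>p^14 x\<close> differ by a double of an
    element of the order.\<close>
  obtain k where k: "p ^ 14 = 2 * k + 1"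
    using odd_p by (metis oddE even_power)
  have "of_nat (p ^ 12) * (of_nat (p ^ 2) * x) \<in> T"
    using L_subset_Q p2_order[OF x] by (auto simp: Q_def)
  then have "of_nat (p ^ 14) * x \<in> T"
    by (simp flip: mult.assoc power_add)
  then have "of_nat (p ^ 14) * x + (- (of_nat k * x) + - (of_nat k * x)) \<in> T"
    using x by (intro T_add T_double order_uminus order_of_nat_mult)
  then show "x \<in> T"
    unfolding k by (simp add: distrib_right mult_2)
qed

end

end

section \<open>Irreducibility of the prime cyclotomic polynomial\<close>

definition rpoly :: "rat poly \<Rightarrow> 'a :: field_char_0 \<Rightarrow> 'a" where
  "rpoly f x = poly (map_poly of_rat f) x"

lemma rpoly_simps [simp]:
  "rpoly 0 x = 0" "rpoly 1 x = 1" "rpoly [:c:] x = of_rat c" "rpoly (monom c n) x = of_rat c * x ^ n"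
  "rpoly (f + f') x = rpoly f x + rpoly f' x" "rpoly (smult c f) x = of_rat c * rpoly f x"
  "rpoly (pCons c f) x = of_rat c + x * rpoly f x"
  by (simp_all add: rpoly_def poly_monom hom_distribs)

lemma rpoly_mult [simp]: "rpoly (f * f') x = rpoly f x * rpoly f' x"
  by (induction f) (simp_all add: algebra_simps)

lemma rpoly_uminus [simp]: "rpoly (- f) x = - rpoly f x"
  using rpoly_simps(6)[of "- 1" f x] by simp

lemma rpoly_diff [simp]: "rpoly (f - f') x = rpoly f x - rpoly f' x"
  using rpoly_simps(5)[of f "- f'" x] by simp

lemma rpoly_pcompose: "rpoly (pcompose f f') x = rpoly f (rpoly f' x)"
  by (simp add: rpoly_def poly_pcompose of_rat_hom.map_poly_pcompose)

lemma rpoly_sum: "rpoly (\<Sum>i\<in>A. f i) x = (\<Sum>i\<in>A. rpoly (f i) x)"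
  by (induction A rule: infinite_finite_induct) auto

lemma rpoly_altdef: "rpoly f x = (\<Sum>i\<le>degree f. of_rat (coeff f i) * x ^ i)"
  unfolding rpoly_def poly_altdef by simp

lemma rpoly_of_int_poly: "rpoly (map_poly of_int F) x = poly (map_poly of_int F) x"
proof -
  have "(of_rat \<circ> of_int) = (of_int :: int \<Rightarrow> 'a)"
    by (rule ext) simp
  then show ?thesis
    by (simp add: rpoly_def map_poly_map_poly)
qed

lemma rat_poly_common_denominator:
  fixes f :: "rat poly"
  obtains d :: int and F :: "int poly" where "d \<noteq> 0" "smult (of_int d) f = map_poly of_int F"
proof -
  have "\<exists>(d::int) F. d \<noteq> 0 \<and> smult (of_int d) f = map_poly of_int F"
  proof (induction f)
    case 0
    show ?case by (rule exI[of _ 1], rule exI[of _ 0]) simp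
  next
    case (pCons c f)
    obtain d F where d: "d \<noteq> 0" "smult (of_int d) f = map_poly of_int F"
      using pCons by blast
    obtain a b where ab: "quotient_of c = (a, b)" by force
    have b: "b > 0" "of_int b * c = of_int a"
      using quotient_of_denom_pos[OF ab] quotient_of_div[OF ab] by auto
    have "smult (of_int (d * b)) (pCons c f) = map_poly of_int (pCons (d * a) (smult b F))"
      by (simp add: of_int_hom.map_poly_pCons_hom of_int_hom.map_poly_hom_smult d(2)[symmetric] b(2)[symmetric] mult_ac)
    then show ?case
      using d(1) b(1) by (intro exI[of _ "d * b"]) auto
  qed
  then show ?thesis using that by blast
qed

text \<open>Let \<open>i\<close> be the first index with \<open>coeff F i\<close> prime to
  \<open>q\<close>. Modulo \<open>q\<close>, coefficient \<open>i\<close> of \<open>F * H\<close> is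
  \<open>coeff F i * coeff H 0\<close>, and \<open>i \<le> degree F\<close> puts it below the
  leading term.\<close>

lemma eisenstein_aux:
  fixes F H :: "int poly" and q :: int
  assumes "prime q" and low: "\<And>i. i < degree (F * H) \<Longrightarrow> q dvd coeff (F * H) i"
    and lead: "\<not> q dvd lead_coeff F" and H0: "\<not> q dvd coeff H 0"
    and deg: "degree F < degree (F * H)"
  shows False
proof -
  define i where "i = (LEAST i. \<not> q dvd coeff F i)"
  have i: "\<not> q dvd coeff F i"
    unfolding i_def using lead by (rule LeastI)
  have below: "q dvd coeff F k" if "k < i" for k
    using not_less_Least that unfolding i_def by blast
  have "i \<le> degree F"
    unfolding i_def using lead by (rule Least_le)
  then have "q dvd coeff (F * H) i"
    using deg low by simp
  also have "coeff (F * H) i = (\<Sum>k<i. coeff F k * coeff H (i - k)) + coeff F i * coeff H 0"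
    by (simp add: coeff_mult flip: lessThan_Suc_atMost)
  finally have "q dvd coeff F i * coeff H 0"
    using below by (subst (asm) dvd_add_right_iff) (auto intro!: dvd_sum)
  then show False
    using prime_dvd_multD[OF assms(1)] i H0 by blast
qed

text \<open>Since \<open>q\<close> divides the constant term of the product exactly once, one factor
  has a constant term prime to \<open>q\<close>; that factor takes the role of \<open>H\<close> in
  \<open>eisenstein_aux\<close>.\<close>

lemma eisenstein_no_factor:
  fixes F H :: "int poly" and q :: int
  assumes q: "prime q" and low: "\<And>i. i < degree (F * H) \<Longrightarrow> q dvd coeff (F * H) i"
    and monic: "lead_coeff (F * H) = 1" and c0: "\<not> q ^ 2 dvd coeff (F * H) 0"
    and deg: "degree F > 0" "degree H > 0"
  shows False
proof -
  have nz: "F \<noteq> 0" "H \<noteq> 0" using deg by auto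
  have dFH: "degree (F * H) = degree F + degree H"
    using nz by (rule degree_mult_eq)
  have lc: "\<not> q dvd lead_coeff F" "\<not> q dvd lead_coeff H"
  proof -
    have "lead_coeff F * lead_coeff H = 1"
      using monic by (simp only: lead_coeff_mult)
    moreover have "\<not> q dvd 1"
      using q not_prime_unit by blast
    ultimately show "\<not> q dvd lead_coeff F" "\<not> q dvd lead_coeff H"
      by (metis dvd_triv_left dvd_trans dvd_triv_right)+
  qed
  have "q dvd coeff F 0 * coeff H 0"
    using low[of 0] deg by (simp add: dFH coeff_mult)
  moreover have "\<not> (q dvd coeff F 0 \<and> q dvd coeff H 0)"
    using c0 by (auto simp: coeff_mult power2_eq_square intro: mult_dvd_mono)
  ultimately consider "\<not> q dvd coeff H 0" | "\<not> q dvd coeff F 0"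
    using prime_dvd_multD[OF q] by blast
  then show False
  proof cases
    case 1
    then show ?thesis
      using eisenstein_aux[OF q, of F H] low lc deg by (simp add: dFH)
  next
    case 2
    then show ?thesis
      using eisenstein_aux[OF q, of H F] low lc deg by (simp add: dFH mult.commute)
  qed
qed

text \<open>A primitive integer polynomial \<open>F\<close> of least degree with root
  \<open>a\<close> divides \<open>G\<close>. By Eisenstein the cofactor is constant, so
  \<open>degree G \<le> degree F \<le> degree f\<close>.\<close>

lemma eisenstein_root_degree:
  fixes f G :: "int poly" and a :: complex and q :: int
  assumes q: "prime q" and low: "\<And>i. i < degree G \<Longrightarrow> q dvd coeff G i"
    and monic: "lead_coeff G = 1" and c0: "\<not> q ^ 2 dvd coeff G 0"
    and Ga: "poly (map_poly of_int G) a = 0"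
    and "f \<noteq> 0" "poly (map_poly of_int f) a = 0"
  shows "degree G \<le> degree f"
proof -
  define P where "P d \<longleftrightarrow> (\<exists>f. f \<noteq> 0 \<and> poly (map_poly of_int f) a = 0 \<and> degree (f :: int poly) = d)" for d
  define d where "d = (LEAST d. P d)"
  have Pf: "P (degree f)"
    using assms(6,7) unfolding P_def by blast
  then obtain m where m: "m \<noteq> 0" "poly (map_poly of_int m) a = 0" "degree m = d"
    using LeastI[of P] unfolding d_def P_def by blast
  have min: "d \<le> degree f'" if "f' \<noteq> 0" "poly (map_poly of_int f') a = 0" for f'
    using that Least_le[of P] unfolding d_def P_def by blast
  define F where "F = primitive_part m"
  have mF: "m = smult (content m) F"
    by (simp add: F_def)
  have F: "F \<noteq> 0" "degree F = d" "content F = 1"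
    using m by (simp_all add: F_def content_primitive_part)
  have "poly (map_poly of_int m) a = of_int (content m) * poly (map_poly of_int F) a"
    by (subst mF) (simp only: of_int_hom.map_poly_hom_smult poly_smult)
  then have Fa: "poly (map_poly of_int F) a = 0"
    using m by simp
  \<comment> \<open>Pseudo-division keeps the coefficients integral at the price of the factor
    \<open>c\<close>; the remainder also vanishes at \<open>a\<close>, so it is 0 by
    minimality.\<close>
  obtain Q R where QR: "pseudo_divmod G F = (Q, R)" by force
  define c where "c = lead_coeff F ^ (Suc (degree G) - degree F)"
  have c: "c \<noteq> 0" "smult c G = F * Q + R" "R = 0 \<or> degree R < degree F"
    using pseudo_divmod[OF F(1) QR] F(1) by (auto simp: c_def)
  have "poly (map_poly of_int (smult c G)) a = 0"
    using Ga by (simp add: of_int_hom.map_poly_hom_smult)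
  then have "poly (map_poly of_int R) a = 0"
    using Fa unfolding c(2) by (simp add: hom_distribs)
  then have "R = 0"
    using min[of R] c(3) F(2) by (cases "R = 0") auto
  with c have cG: "smult c G = F * Q" by simp
  \<comment> \<open>Gauss's lemma: comparing contents in \<open>c G = F Q\<close> shows that the
    content of \<open>Q\<close> is \<open>c\<close> up to sign, so \<open>c\<close> cancels over the
    integers.\<close>
  have "content G = 1"
  proof -
    have "content G dvd coeff G (degree G)" by (rule content_dvd_coeff)
    then have "is_unit (content G)" using monic by simp
    then have "normalize (content G) = 1" by (rule is_unit_normalize)
    then show ?thesis by (metis normalize_content)
  qed
  then have "content Q = normalize c"
    using arg_cong[OF cG, of content] F(3) by (simp add: content_mult)
  then have "smult c G = F * smult (normalize c) (primitive_part Q)"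
    using cG content_times_primitive_part[of Q] by simp
  also have "normalize c = c * sgn c"
    by (simp add: abs_sgn)
  finally have "smult c (G - F * smult (sgn c) (primitive_part Q)) = 0"
    by (simp add: smult_diff_right)
  then have GF: "G = F * smult (sgn c) (primitive_part Q)"
    using c(1) by simp
  let ?H = "smult (sgn c) (primitive_part Q)"
  have "degree F > 0"
  proof (rule ccontr)
    assume "\<not> degree F > 0"
    then obtain b where "F = [:b:]" by (auto elim: degree_eq_zeroE)
    then show False using F(1) Fa by simp
  qed
  then have "degree ?H = 0"
    using eisenstein_no_factor[OF q, of F ?H] low monic c0 unfolding GF by blast
  then have "degree G \<le> degree F"
    using degree_mult_le[of F ?H] by (simp only: GF[symmetric])
  also have "degree F \<le> degree f"
    using min assms(6,7) F(2) by simp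
  finally show ?thesis .
qed

text \<open>Eisenstein's criterion is applied to \<open>((X + 1)\<^sup>p - 1) / X\<close>, which has the root \<open>\<xi> - 1\<close>.\<close>

lemma root_of_unity_degree_int:
  fixes \<xi> :: complex and f :: "int poly"
  assumes p: "prime p" and \<xi>: "\<xi> ^ p = 1" "\<xi> \<noteq> 1" and f: "f \<noteq> 0" "poly (map_poly of_int f) \<xi> = 0"
  shows "p - 1 \<le> degree f"
proof -
  define G :: "int poly" where "G = (\<Sum>k<p. monom (int (p choose Suc k)) k)"
  have p1: "p > 1" using p prime_gt_1_nat by simp
  have coeff: "coeff G k = (if k < p then int (p choose Suc k) else 0)" for k
    by (simp add: G_def coeff_sum)
  have deg: "degree G = p - 1"
  proof (rule antisym)
    show "degree G \<le> p - 1"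
      using p1 by (intro degree_le) (auto simp: coeff)
    show "p - 1 \<le> degree G"
      using p1 by (intro le_degree) (simp add: coeff)
  qed
  have low: "int p dvd coeff G i" if "i < degree G" for i
    using that p unfolding deg coeff by (auto intro!: dvd_choose_prime)
  have monic: "lead_coeff G = 1"
    using p1 unfolding deg coeff by simp
  have c0: "\<not> (int p) ^ 2 dvd coeff G 0"
  proof
    assume "(int p) ^ 2 dvd coeff G 0"
    then have "int p * int p dvd int p * 1"
      using p1 by (simp add: coeff power2_eq_square)
    then have "int p dvd 1"
      using p1 by (subst (asm) dvd_mult_cancel_left) auto
    then show False using p1 by simp
  qed
  have ev: "poly (map_poly of_int G) z = (\<Sum>k<p. of_nat (p choose Suc k) * z ^ k)" for z :: complex
    by (simp add: G_def of_int_poly_hom.hom_sum poly_sum poly_monom)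
  have "(\<xi> - 1) * poly (map_poly of_int G) (\<xi> - 1) = (\<Sum>k<p. of_nat (p choose Suc k) * (\<xi> - 1) ^ Suc k)"
    by (simp add: ev sum_distrib_left mult_ac)
  also have "\<dots> = (\<Sum>k\<le>p. of_nat (p choose k) * (\<xi> - 1) ^ k) - 1"
    by (simp add: sum.atMost_shift)
  also have "\<dots> = 0"
    using binomial_ring[of "\<xi> - 1" 1 p] \<xi>(1) by simp
  finally have root: "poly (map_poly of_int G) (\<xi> - 1) = 0"
    using \<xi>(2) by simp
  define f' where "f' = pcompose f [:1, 1:]"
  have "degree f' = degree f"
    by (simp add: f'_def)
  moreover have "f' \<noteq> 0"
    using f(1) unfolding f'_def by (simp add: pcompose_eq_0_iff)
  moreover have "poly (map_poly of_int f') (\<xi> - 1) = 0"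
    using f(2) by (simp add: f'_def of_int_hom.map_poly_pcompose poly_pcompose of_int_hom.map_poly_pCons_hom)
  ultimately show ?thesis
    using eisenstein_root_degree[of "int p" G "\<xi> - 1" f'] p low monic c0 root deg by simp
qed

lemma root_of_unity_degree_rat:
  fixes \<xi> :: complex and f :: "rat poly"
  assumes "prime p" "\<xi> ^ p = 1" "\<xi> \<noteq> 1" "rpoly f \<xi> = 0" "degree f < p - 1"
  shows "f = 0"
proof (rule ccontr)
  assume "f \<noteq> 0"
  obtain d F where d: "d \<noteq> 0" "smult (of_int d) f = map_poly of_int (F :: int poly)"
    using rat_poly_common_denominator .
  have "poly (map_poly of_int F) \<xi> = rpoly (smult (of_int d) f) \<xi>"
    by (simp only: d(2) rpoly_of_int_poly)
  then have "poly (map_poly of_int F) \<xi> = 0"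
    using assms by simp
  moreover have "degree F = degree f"
    using arg_cong[OF d(2), of degree] d(1) by simp
  moreover have "F \<noteq> 0"
    using d \<open>f \<noteq> 0\<close> by auto
  ultimately show False
    using root_of_unity_degree_int[OF assms(1-3), of F] assms(5) by simp
qed

section \<open>Cyclic cubic fields\<close>

lemma of_rat_quotient:
  assumes "quotient_of q = (a, b)"
  shows "(of_rat q :: complex) = of_int a / of_int b"
  by (subst quotient_of_div[OF assms]) (simp add: of_rat_divide)

lemma rat_scale_complex: "rat_scale q x = of_rat q * (x :: complex)"
proof -
  obtain a b where ab: "quotient_of q = (a, b)" by force
  show ?thesis
    by (simp add: rat_scale_def ab of_rat_quotient[OF ab])
qed

lemma subfield_of_rat:
  assumes "is_subfield F"
  shows "of_rat q \<in> F"
proof -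
  obtain a b where ab: "quotient_of q = (a, b)" by force
  have nat: "of_nat n \<in> F" for n
    using assms by (induction n) (auto simp: is_subfield_def)
  have int: "of_int n \<in> F" for n
    using nat assms unfolding is_subfield_def
    by (cases n) (simp_all only: of_int_of_nat_eq of_int_minus)
  have "(of_rat q :: complex) = of_int a * inverse (of_int b)"
    using of_rat_quotient[OF ab] by (simp add: divide_inverse)
  then show ?thesis
    using int assms by (simp add: is_subfield_def)
qed

lemma span3_iff:
  "w \<in> rat_vs.span {x, y, z :: complex} \<longleftrightarrow> (\<exists>a b c. w = of_rat a * x + of_rat b * y + of_rat c * z)"
  by (auto simp: rat_vs.span_breakdown_eq rat_scale_complex algebra_simps)

lemma independent3:
  fixes x y z :: complex
  assumes "\<And>a b c. of_rat a * x + of_rat b * y + of_rat c * z = 0 \<Longrightarrow> a = 0 \<and> b = 0 \<and> c = 0"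
  shows "card {x, y, z} = 3" "rat_vs.independent {x, y, z}"
proof -
  have d: "x \<noteq> y" "x \<noteq> z" "y \<noteq> z"
    using assms[of 1 "- 1" 0] assms[of 1 0 "- 1"] assms[of 0 1 "- 1"] by (auto simp: of_rat_minus)
  then show "card {x, y, z} = 3" by simp
  show "rat_vs.independent {x, y, z}"
  proof
    assume "rat_vs.dependent {x, y, z}"
    then obtain u where u: "\<exists>v\<in>{x, y, z}. u v \<noteq> 0" "(\<Sum>v\<in>{x, y, z}. rat_scale (u v) v) = 0"
      using rat_vs.dependent_finite[of "{x, y, z}"] by auto
    then show False
      using d assms[of "u x" "u y" "u z"] by (auto simp: rat_scale_complex add.assoc)
  qed
qed

text \<open>Steinitz exchange: an element of \<open>T\<close> outside the span of \<open>B\<close>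
  would enlarge \<open>B\<close> to an independent set, inside the span of \<open>T\<close>, with
  more than \<open>card T\<close> elements.\<close>

lemma span_eq_if_card_le:
  fixes B T :: "complex set"
  assumes "rat_vs.independent B" "finite T" "card T \<le> card B" "B \<subseteq> rat_vs.span T"
  shows "T \<subseteq> rat_vs.span B"
proof
  fix t assume t: "t \<in> T"
  show "t \<in> rat_vs.span B"
  proof (rule ccontr)
    assume n: "t \<notin> rat_vs.span B"
    then have "t \<notin> B"
      using rat_vs.span_base by blast
    have "rat_vs.independent (insert t B)"
      by (rule rat_vs.independent_insertI[OF n assms(1)])
    moreover have "insert t B \<subseteq> rat_vs.span T"
      using t assms(4) rat_vs.span_base by blast
    ultimately have "finite (insert t B) \<and> card (insert t B) \<le> card T"
      by (rule rat_vs.independent_span_bound[OF assms(2)])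
    then show False
      using \<open>t \<notin> B\<close> assms(3) card_insert_disjoint[of B t] by auto
  qed
qed

text \<open>A Vandermonde argument by divided differences; it yields both the independence of
  \<open>1\<close>, \<open>z\<close>, \<open>z^2\<close> and the fixed field of
  \<open>S\<close>.\<close>

lemma quadratic_three_roots:
  fixes a b c x y z :: complex
  assumes "a + b * x + c * (x * x) = 0" "a + b * y + c * (y * y) = 0" "a + b * z + c * (z * z) = 0"
    and d: "x \<noteq> y" "x \<noteq> z" "y \<noteq> z"
  shows "a = 0 \<and> b = 0 \<and> c = 0"
proof -
  have "(x - y) * (b + c * (x + y)) = (a + b * x + c * (x * x)) - (a + b * y + c * (y * y))"
    "(x - z) * (b + c * (x + z)) = (a + b * x + c * (x * x)) - (a + b * z + c * (z * z))"
    by (simp_all add: algebra_simps)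
  then have e: "b + c * (x + y) = 0" "b + c * (x + z) = 0"
    using d assms(1-3) by simp_all
  have "c * (y - z) = (b + c * (x + y)) - (b + c * (x + z))"
    by (simp add: algebra_simps)
  then have "c = 0" using d e by simp
  then show ?thesis using e assms(1) by simp
qed

section \<open>The Galois group of a cyclic cubic field\<close>

lemma subgroup_Gal:
  assumes "is_subfield Z"
  shows "subgroup (carrier (Gal Z)) (BijGroup Z)"
proof
  have carr: "f \<in> carrier (Gal Z) \<longleftrightarrow> f \<in> Bij Z \<and>
    (\<forall>x\<in>Z. \<forall>y\<in>Z. f (x + y) = f x + f y \<and> f (x * y) = f x * f y) \<and> (\<forall>q. f (of_rat q) = of_rat q)" for f
    by (simp add: Gal_def)
  have clos: "\<And>x y. x \<in> Z \<Longrightarrow> y \<in> Z \<Longrightarrow> x + y \<in> Z" "\<And>x y. x \<in> Z \<Longrightarrow> y \<in> Z \<Longrightarrow> x * y \<in> Z"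
    using assms by (auto simp: is_subfield_def)
  show "carrier (Gal Z) \<subseteq> carrier (BijGroup Z)"
    by (auto simp: carr BijGroup_def)
  show "\<one>\<^bsub>BijGroup Z\<^esub> \<in> carrier (Gal Z)"
    using clos subfield_of_rat[OF assms] by (auto simp: carr BijGroup_def id_Bij)
  show "f \<otimes>\<^bsub>BijGroup Z\<^esub> f' \<in> carrier (Gal Z)" if "f \<in> carrier (Gal Z)" "f' \<in> carrier (Gal Z)" for f f'
  proof -
    have "f' x \<in> Z" if "x \<in> Z" for x
      using that \<open>f' \<in> _\<close> Bij_imp_funcset[of f' Z] by (auto simp: carr)
    then show ?thesis
      using that clos subfield_of_rat[OF assms] compose_Bij[of f Z f']
      by (auto simp: carr BijGroup_def compose_def)
  qed
  show "inv\<^bsub>BijGroup Z\<^esub> f \<in> carrier (Gal Z)" if "f \<in> carrier (Gal Z)" for f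
  proof -
    have f: "f \<in> Bij Z" using that by (simp add: carr)
    have "inv_into Z f (x + y) = inv_into Z f x + inv_into Z f y"
      "inv_into Z f (x * y) = inv_into Z f x * inv_into Z f y" if "x \<in> Z" "y \<in> Z" for x y
      using Bij_inv_into_lemma[of Z f "(+)" x y] Bij_inv_into_lemma[of Z f "(*)" x y] f that clos
        \<open>f \<in> carrier (Gal Z)\<close> by (auto simp: carr)
    moreover have "inv_into Z f (of_rat q) = of_rat q" for q
    proof -
      have "f (of_rat q) = of_rat q" "inj_on f Z"
        using that by (auto simp: carr Bij_def bij_betw_def)
      then show ?thesis
        using inv_into_f_f subfield_of_rat[OF assms] by metis
    qed
    ultimately show ?thesis
      using f clos subfield_of_rat[OF assms]
      by (simp add: inv_BijGroup carr restrict_inv_into_Bij)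
  qed
qed

locale cyclic_cubic =
  fixes Z :: "complex set" and S :: "complex \<Rightarrow> complex"
  assumes cyclic: "cyclic_field 3 Z S"
begin

lemma subfield: "is_subfield Z" and dim: "rat_vs.dim Z = 3" and order: "Coset.order (Gal Z) = 3"
  and S_Gal: "S \<in> carrier (Gal Z)" and generate: "generate (Gal Z) {S} = carrier (Gal Z)"
  using cyclic by (auto simp: cyclic_field_def)

lemma Z_add: "x \<in> Z \<Longrightarrow> y \<in> Z \<Longrightarrow> x + y \<in> Z" and Z_mult: "x \<in> Z \<Longrightarrow> y \<in> Z \<Longrightarrow> x * y \<in> Z"
  and Z_0: "0 \<in> Z" and Z_1: "1 \<in> Z" 
  using subfield by (auto simp: is_subfield_def)

lemmas Z_of_rat = subfield_of_rat[OF subfield]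

lemma Z_of_int: "of_int n \<in> Z"
  using Z_of_rat[of "of_int n"] by simp

lemma S_Bij: "S \<in> Bij Z" and S_of_rat: "S (of_rat q) = of_rat q"
  and S_add: "x \<in> Z \<Longrightarrow> y \<in> Z \<Longrightarrow> S (x + y) = S x + S y"
  and S_mult: "x \<in> Z \<Longrightarrow> y \<in> Z \<Longrightarrow> S (x * y) = S x * S y"
  using S_Gal by (auto simp: Gal_def)

lemma S_in: "x \<in> Z \<Longrightarrow> S x \<in> Z"
  using Bij_imp_funcset[OF S_Bij] by auto

lemma S_inj: "x \<in> Z \<Longrightarrow> y \<in> Z \<Longrightarrow> S x = S y \<longleftrightarrow> x = y"
  using S_Bij by (auto simp: Bij_def bij_betw_def inj_on_def)

lemma group_Gal: "group (Gal Z)"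
proof -
  have "Gal Z = BijGroup Z\<lparr>carrier := carrier (Gal Z)\<rparr>"
    by (simp add: Gal_def)
  then show ?thesis
    using group.subgroup_imp_group[OF group_BijGroup subgroup_Gal[OF subfield]] by simp
qed

text \<open>Lagrange's theorem in a group of order 3, whose identity is the identity map restricted
  to \<open>Z\<close>.\<close>

lemma S_cube:
  assumes "z \<in> Z"
  shows "S (S (S z)) = z"
proof -
  have "S [^]\<^bsub>Gal Z\<^esub> (3 :: nat) = \<one>\<^bsub>Gal Z\<^esub>"
    using group.pow_order_eq_1[OF group_Gal S_Gal] order by simp
  moreover have "S [^]\<^bsub>Gal Z\<^esub> (3 :: nat) = S \<otimes>\<^bsub>Gal Z\<^esub> S \<otimes>\<^bsub>Gal Z\<^esub> S"
    using monoid.nat_pow_Suc[OF group.is_monoid[OF group_Gal]] S_Gal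
      group.is_monoid[OF group_Gal] by (simp add: numeral_3_eq_3 monoid.l_one)
  moreover have "S \<otimes>\<^bsub>Gal Z\<^esub> S \<otimes>\<^bsub>Gal Z\<^esub> S = compose Z (compose Z S S) S"
    using S_Bij by (simp add: Gal_def BijGroup_def compose_Bij)
  moreover have "\<one>\<^bsub>Gal Z\<^esub> = (\<lambda>x\<in>Z. x)"
    by (simp add: Gal_def BijGroup_def)
  ultimately have "compose Z (compose Z S S) S z = z"
    using assms by simp
  then show ?thesis
    using assms S_in by (simp add: compose_def)
qed

text \<open>If \<open>S\<close> fixed \<open>Z\<close> pointwise, extensionality would make it the
  identity of \<open>Gal Z\<close>, which generates one element instead of three.\<close>

lemma S_moves: "\<exists>z\<in>Z. S z \<noteq> z"
proof (rule ccontr)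
  assume "\<not> ?thesis"
  then have "S = \<one>\<^bsub>Gal Z\<^esub>"
    using S_Bij by (auto simp: Gal_def BijGroup_def Bij_def intro!: extensionalityI[of S Z])
  then have "generate (Gal Z) {S} \<subseteq> {\<one>\<^bsub>Gal Z\<^esub>}"
    using group.generate_subgroup_incl[OF group_Gal _ group.triv_subgroup[OF group_Gal]] by simp
  then have "card (carrier (Gal Z)) \<le> 1"
    unfolding generate using card_mono[of "{\<one>\<^bsub>Gal Z\<^esub>}"] by fastforce
  then show False
    using order by (simp add: Coset.order_def)
qed

lemma orbit_distinct:
  assumes "z \<in> Z" "S z \<noteq> z"
  shows "z \<noteq> S z" "z \<noteq> S (S z)" "S z \<noteq> S (S z)"
proof -
  show "z \<noteq> S z" using assms by simp
  show "S z \<noteq> S (S z)" using assms S_inj S_in by metis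
  show "z \<noteq> S (S z)"
    using assms S_cube[OF assms(1)] by metis
qed

lemma basis:
  obtains B where "B \<subseteq> Z" "rat_vs.independent B" "Z \<subseteq> rat_vs.span B" "card B = 3" "finite B"
proof -
  obtain B where B: "B \<subseteq> Z" "rat_vs.independent B" "Z \<subseteq> rat_vs.span B" "card B = 3"
    using rat_vs.basis_exists[of Z] dim by metis
  moreover from this have "finite B"
    by (intro card_ge_0_finite) simp
  ultimately show ?thesis using that by blast
qed

lemma span_Z: "B \<subseteq> Z \<Longrightarrow> rat_vs.span B \<subseteq> Z"
  by (intro rat_vs.span_minimal)
    (auto simp: rat_vs.subspace_def rat_scale_complex Z_0 intro: Z_add Z_mult Z_of_rat)

text \<open>By dimension, a span of three elements that contains \<open>Z\<close> equals
  \<open>Z\<close>, and the three are distinct. Applied to the periods, this places them inside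
  \<open>Z\<close>.\<close>

lemma spanning_triple:
  assumes "Z \<subseteq> rat_vs.span {x, y, z}"
  shows "{x, y, z} \<subseteq> Z" "card {x, y, z} = 3"
proof -
  obtain B where B: "B \<subseteq> Z" "rat_vs.independent B" "Z \<subseteq> rat_vs.span B" "card B = 3" "finite B"
    using basis .
  have le: "card {x, y, z} \<le> 3"
    by (simp add: card_insert_if)
  have B_span: "B \<subseteq> rat_vs.span {x, y, z}"
    using B assms by blast
  show "{x, y, z} \<subseteq> Z"
    using B_span span_eq_if_card_le[OF B(2), of "{x, y, z}"] le B(4) span_Z[OF B(1)] by auto
  show "card {x, y, z} = 3"
    using rat_vs.independent_span_bound[OF _ B(2), of "{x, y, z}"] B_span B(4) le by auto
qed

lemma quadratic_S:
  assumes "z \<in> Z"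
  shows "S (of_rat a + of_rat b * z + of_rat c * (z * z)) = of_rat a + of_rat b * S z + of_rat c * (S z * S z)"
  using assms by (simp add: S_add S_mult S_of_rat Z_add Z_mult Z_of_rat)

text \<open>Applying \<open>S\<close> twice to a relation \<open>a + b z + c z^2 = 0\<close> gives a
  quadratic with three distinct roots. So \<open>1\<close>, \<open>z\<close>, \<open>z^2\<close> are
  independent and, by dimension, a basis.\<close>

lemma primitive:
  assumes z: "z \<in> Z" "S z \<noteq> z" and "w \<in> Z"
  shows "\<exists>a b c. w = of_rat a + of_rat b * z + of_rat c * (z * z)"
proof -
  have "a = 0 \<and> b = 0 \<and> c = 0" if "of_rat a * 1 + of_rat b * z + of_rat c * (z * z) = 0" for a b c
  proof -
    have 0: "of_rat a + of_rat b * z + of_rat c * (z * z) = 0" using that by simp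
    have 1: "of_rat a + of_rat b * S z + of_rat c * (S z * S z) = 0"
      using arg_cong[OF 0, of S] quadratic_S[OF z(1), of a b c] S_of_rat[of 0] by simp
    have 2: "of_rat a + of_rat b * S (S z) + of_rat c * (S (S z) * S (S z)) = 0"
      using arg_cong[OF 1, of S] quadratic_S[OF S_in[OF z(1)], of a b c] S_of_rat[of 0] by simp
    show ?thesis
      using quadratic_three_roots[OF 0 1 2 orbit_distinct[OF z]] by simp
  qed
  note ind = independent3[of 1 z "z * z", OF this]
  obtain B where B: "B \<subseteq> Z" "rat_vs.independent B" "Z \<subseteq> rat_vs.span B" "card B = 3" "finite B"
    using basis .
  have "{1, z, z * z} \<subseteq> rat_vs.span B"
    using B(3) z(1) Z_1 Z_mult by blast
  then have "B \<subseteq> rat_vs.span {1, z, z * z}"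
    using span_eq_if_card_le[OF ind(2) B(5)] ind(1) B(4) by simp
  then have "w \<in> rat_vs.span {1, z, z * z}"
    using assms(3) B(3) rat_vs.span_minimal[OF _ rat_vs.subspace_span] by blast
  then show ?thesis
    by (simp add: span3_iff)
qed

text \<open>Write \<open>w = a + b z + c z^2\<close>. Applying \<open>S\<close> shows that
  \<open>(a - w) + b X + c X^2\<close> has the three roots \<open>z\<close>, \<open>S z\<close>,
  \<open>S (S z)\<close>, so \<open>w = a\<close>.\<close>

lemma fixed_rational:
  assumes "w \<in> Z" "S w = w"
  shows "\<exists>q. w = of_rat q"
proof -
  obtain z where z: "z \<in> Z" "S z \<noteq> z"
    using S_moves by blast
  obtain a b c where w: "w = of_rat a + of_rat b * z + of_rat c * (z * z)"
    using primitive[OF z assms(1)] by blast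
  have w1: "w = of_rat a + of_rat b * S z + of_rat c * (S z * S z)"
    using quadratic_S[OF z(1), of a b c] assms(2) w by simp
  have w2: "w = of_rat a + of_rat b * S (S z) + of_rat c * (S (S z) * S (S z))"
    using quadratic_S[OF S_in[OF z(1)], of a b c] assms(2) w1 by simp
  have "of_rat a - w = 0"
    using quadratic_three_roots[of "of_rat a - w" "of_rat b" z "of_rat c" "S z" "S (S z)"]
      w w1 w2 orbit_distinct[OF z] by (simp add: algebra_simps)
  then show ?thesis by (intro exI[of _ a]) simp
qed

text \<open>The image of a primitive \<open>z\<close> is a root of the rational cubic of
  \<open>z\<close>, hence a conjugate of \<open>z\<close>, and it determines \<open>\<phi>\<close>
  on all of \<open>Z\<close>.\<close>

lemma embedding_is_power:
  assumes add: "\<And>x y. x \<in> Z \<Longrightarrow> y \<in> Z \<Longrightarrow> \<phi> (x + y) = \<phi> x + \<phi> y"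
    and mult: "\<And>x y. x \<in> Z \<Longrightarrow> y \<in> Z \<Longrightarrow> \<phi> (x * y) = \<phi> x * \<phi> y"
    and rat: "\<And>q. \<phi> (of_rat q) = of_rat q"
  shows "\<exists>i<3. \<forall>z\<in>Z. \<phi> z = (S ^^ i) z"
proof -
  obtain z where z: "z \<in> Z" "S z \<noteq> z"
    using S_moves by blast
  define z1 z2 where "z1 = S z" and "z2 = S z1"
  have in1: "z1 \<in> Z" "z2 \<in> Z" using z S_in by (auto simp: z1_def z2_def)
  have z2: "S z2 = z" using S_cube[OF z(1)] by (simp add: z1_def z2_def)
  note cl = Z_add Z_mult z(1) in1
  note Ss = S_add S_mult z2 z1_def[symmetric] z2_def[symmetric] cl
  \<comment> \<open>The elementary symmetric functions of the orbit of \<open>z\<close> are fixed by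
    \<open>S\<close>, hence rational.\<close>
  obtain q1 where q1: "z + z1 + z2 = of_rat q1"
    using fixed_rational[of "z + z1 + z2"] by (auto simp: Ss add_ac)
  obtain q2 where q2: "z * z1 + z * z2 + z1 * z2 = of_rat q2"
    using fixed_rational[of "z * z1 + z * z2 + z1 * z2"] by (auto simp: Ss add_ac mult_ac)
  obtain q3 where q3: "z * (z1 * z2) = of_rat q3"
    using fixed_rational[of "z * (z1 * z2)"] by (auto simp: Ss mult_ac)
  \<comment> \<open>The cubic equation is arranged without subtraction because the hypotheses on
    \<open>\<phi>\<close> speak of sums and products.\<close>
  have "z * (z * z) + of_rat q2 * z = of_rat q1 * (z * z) + of_rat q3"
    unfolding q1[symmetric] q2[symmetric] q3[symmetric] by (simp add: algebra_simps)
  then have "\<phi> (z * (z * z) + of_rat q2 * z) = \<phi> (of_rat q1 * (z * z) + of_rat q3)"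
    by simp
  then have eq: "\<phi> z * (\<phi> z * \<phi> z) + of_rat q2 * \<phi> z = of_rat q1 * (\<phi> z * \<phi> z) + of_rat q3"
    using z(1) by (simp add: add mult rat Z_add Z_mult Z_of_rat)
  have "(\<phi> z - z) * ((\<phi> z - z1) * (\<phi> z - z2)) =
    \<phi> z * (\<phi> z * \<phi> z) + of_rat q2 * \<phi> z - (of_rat q1 * (\<phi> z * \<phi> z) + of_rat q3)"
    unfolding q1[symmetric] q2[symmetric] q3[symmetric] by (simp add: algebra_simps)
  then consider "\<phi> z = (S ^^ 0) z" | "\<phi> z = (S ^^ 1) z" | "\<phi> z = (S ^^ 2) z"
    using eq by (auto simp: z1_def z2_def numeral_2_eq_2)
  then have "\<exists>i<3. \<phi> z = (S ^^ i) z"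
  proof cases
    case 1
    then show ?thesis by (intro exI[of _ 0]) simp
  next
    case 2
    then show ?thesis by (intro exI[of _ 1]) simp
  next
    case 3
    then show ?thesis by (intro exI[of _ 2]) simp
  qed
  then obtain i where i: "i < 3" "\<phi> z = (S ^^ i) z"
    by blast
  have Sk: "(S ^^ k) z \<in> Z" for k
    by (induction k) (simp_all add: z S_in)
  have Si: "(S ^^ k) (of_rat a + of_rat b * z + of_rat c * (z * z)) =
      of_rat a + of_rat b * (S ^^ k) z + of_rat c * ((S ^^ k) z * (S ^^ k) z)" for k a b c
    by (induction k) (simp_all add: quadratic_S[OF Sk])
  have "\<phi> w = (S ^^ i) w" if w: "w \<in> Z" for w
  proof -
    obtain a b c where w_eq: "w = of_rat a + of_rat b * z + of_rat c * (z * z)"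
      using primitive[OF z w] by blast
    have "\<phi> w = of_rat a + of_rat b * \<phi> z + of_rat c * (\<phi> z * \<phi> z)"
      unfolding w_eq using z(1) by (simp add: add mult rat Z_add Z_mult Z_of_rat)
    then show ?thesis
      unfolding w_eq using Si i(2) by simp
  qed
  then show ?thesis using i(1) by blast
qed

end

section \<open>Cubic Gaussian periods\<close>

text \<open>This and the next rearrangement live in \<open>comm_monoid_set\<close> so that they
  apply to the sums in \<open>per\<close> as well as to the products in \<open>beta\<close>.\<close>

lemma (in comm_monoid_set) cyclic_shift:
  fixes c :: "nat \<Rightarrow> 'a"
  assumes "\<And>r. c (r + h) = c r"
  shows "F (\<lambda>r. c (r + s)) {..<h} = F c {..<h}"
proof (induction s)
  case (Suc s)
  show ?case
  proof (cases h)
    case (Suc h')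
    have "F (\<lambda>r. c (r + Suc s)) {..<h} = F (\<lambda>r. c (Suc r + s)) {..<h'} \<^bold>* c (s + h)"
      by (simp add: Suc lessThan_Suc add.commute del: add_Suc_right) (simp add: add.commute commute)
    also have "\<dots> = F (\<lambda>r. c (r + s)) {..<h}"
      unfolding assms by (simp only: Suc lessThan_Suc_shift) (simp add: commute)
    finally show ?thesis using Suc.IH by simp
  qed simp
qed simp

lemma (in comm_monoid_set) residues_mod_3:
  fixes c :: "nat \<Rightarrow> 'a"
  shows "F c {..<3 * h} =
    F (\<lambda>r. c (3 * r)) {..<h} \<^bold>* F (\<lambda>r. c (1 + 3 * r)) {..<h} \<^bold>* F (\<lambda>r. c (2 + 3 * r)) {..<h}"
proof (induction h)
  case (Suc h)
  have 3: "3 * Suc h = Suc (Suc (Suc (3 * h)))" by simp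
  have "F c {..<3 * Suc h} = F c {..<3 * h} \<^bold>* c (3 * h) \<^bold>* c (1 + 3 * h) \<^bold>* c (2 + 3 * h)"
    unfolding 3 by (simp add: lessThan_Suc left_commute commute assoc)
  then show ?case
    using Suc by (simp add: lessThan_Suc left_commute commute assoc)
qed simp

section \<open>Powers of a primitive \<open>p\<close>-th root of unity\<close>

locale cyclotomic_prime =
  fixes p :: nat and \<xi> :: complex
  assumes p: "prime p" and \<xi>_p: "\<xi> ^ p = 1" and \<xi>_1: "\<xi> \<noteq> 1"
begin

lemma p_gt_1: "p > 1"
  using p prime_gt_1_nat by simp

lemma pow_mod: "\<xi> ^ (n mod p) = \<xi> ^ n"
proof -
  have "\<xi> ^ n = (\<xi> ^ p) ^ (n div p) * \<xi> ^ (n mod p)"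
    by (simp flip: power_mult power_add)
  then show ?thesis by (simp add: \<xi>_p)
qed

lemma pow_cong: "[m = n] (mod p) \<Longrightarrow> \<xi> ^ m = \<xi> ^ n"
  by (metis cong_def pow_mod)

lemma pow_eq_1_iff: "\<xi> ^ n = 1 \<longleftrightarrow> p dvd n"
proof
  assume "p dvd n"
  then show "\<xi> ^ n = 1"
    using pow_cong[of n 0] by (simp add: cong_0_iff)
next
  assume 1: "\<xi> ^ n = 1"
  show "p dvd n"
  proof (rule ccontr)
    assume "\<not> p dvd n"
    then have "coprime n p"
      using p prime_imp_coprime coprime_commute by blast
    then obtain x where "[n * x = Suc 0] (mod p)"
      using cong_solve_coprime_nat by blast
    then have "\<xi> ^ (n * x) = \<xi> ^ Suc 0"
      by (rule pow_cong)
    then show False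
      using 1 \<xi>_1 by (simp add: power_mult)
  qed
qed

lemma pow_inj: "inj_on (\<lambda>n. \<xi> ^ n) {..<p}"
proof (rule linorder_inj_onI)
  fix m n :: nat
  assume mn: "m < n" "m \<in> {..<p}" "n \<in> {..<p}"
  show "\<xi> ^ m \<noteq> \<xi> ^ n"
  proof
    assume "\<xi> ^ m = \<xi> ^ n"
    also have "\<xi> ^ n = \<xi> ^ m * \<xi> ^ (n - m)"
      using mn by (simp flip: power_add)
    moreover have "\<xi> \<noteq> 0"
      using \<xi>_p p_gt_1 by (auto simp: zero_power)
    ultimately have "\<xi> ^ (n - m) = 1"
      by (metis mult_cancel_left mult.right_neutral power_not_zero)
    then have "p dvd n - m" by (simp add: pow_eq_1_iff)
    then show False using mn by (auto dest: dvd_imp_le)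
  qed
qed auto

lemma sum_powers:
  assumes "\<not> p dvd n"
  shows "(\<Sum>i<p. (\<xi> ^ n) ^ i) = 0"
proof -
  have "\<xi> ^ n \<noteq> 1" using assms pow_eq_1_iff by simp
  moreover have "(\<xi> ^ n) ^ p = 1"
    by (metis \<xi>_p mult.commute power_mult power_one)
  ultimately show ?thesis
    by (simp add: geometric_sum)
qed

text \<open>The \<open>p\<close> distinct powers of \<xi> exhaust the \<open>p\<close> roots. This
  links the arbitrary root \<xi> to the root \<open>cis (2 * pi / real p)\<close> that defines
  \<open>cyclotomic_field\<close>.\<close>

lemma roots_of_unity_powers:
  assumes "z ^ p = 1"
  shows "\<exists>n. z = \<xi> ^ n"
proof -
  have "card ((\<lambda>n. \<xi> ^ n) ` {..<p}) = card {z :: complex. z ^ p = 1}"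
    using card_image[OF pow_inj] card_roots_unity_eq p_gt_1 by simp
  moreover have "(\<lambda>n. \<xi> ^ n) ` {..<p} \<subseteq> {z :: complex. z ^ p = 1}"
    by (auto simp: power_mult[symmetric] pow_eq_1_iff)
  moreover have "finite {z :: complex. z ^ p = 1}"
    using finite_roots_unity[of p, where 'a = complex] p_gt_1 by simp
  ultimately have "(\<lambda>n. \<xi> ^ n) ` {..<p} = {z :: complex. z ^ p = 1}"
    by (intro card_subset_eq)
  then show ?thesis using assms by auto
qed

lemma rpoly_degree: "rpoly f \<xi> = 0 \<Longrightarrow> degree f < p - 1 \<Longrightarrow> f = 0"
  using root_of_unity_degree_rat[OF p \<xi>_p \<xi>_1] .

text \<open>The \<open>p\<close>-th cyclotomic polynomial, as \<open>p\<close> is prime.\<close>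

definition \<Phi> :: "rat poly" where
  "\<Phi> = (\<Sum>i<p. monom 1 i)"

lemma degree_\<Phi>: "degree \<Phi> = p - 1"
proof (rule antisym)
  show "degree \<Phi> \<le> p - 1"
    unfolding \<Phi>_def using p_gt_1 by (intro degree_sum_le) (auto simp: degree_monom_eq)
  have "coeff \<Phi> (p - 1) = 1"
    using p_gt_1 by (simp add: \<Phi>_def coeff_sum)
  then show "p - 1 \<le> degree \<Phi>"
    by (intro le_degree) simp
qed

lemma \<Phi>_nz: "\<Phi> \<noteq> 0"
  using degree_\<Phi> p_gt_1 by auto

lemma rpoly_\<Phi>: "\<not> p dvd n \<Longrightarrow> rpoly \<Phi> (\<xi> ^ n) = 0"
  by (simp add: \<Phi>_def rpoly_sum sum_powers)

lemma rpoly_\<Phi>_\<xi>: "rpoly \<Phi> \<xi> = 0"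
  using rpoly_\<Phi>[of 1] p_gt_1 by simp

text \<open>Makes the substitution of \<xi>^n for \<xi> well defined: the remainder of
  \<open>f\<close> modulo \<open>\<Phi>\<close> vanishes at \<xi> with degree below
  \<open>p - 1\<close>, so it is 0, and multiples of \<open>\<Phi>\<close> vanish at \<xi>^n
  too.\<close>

lemma rpoly_conjugate:
  assumes "rpoly f \<xi> = 0" "\<not> p dvd n"
  shows "rpoly f (\<xi> ^ n) = 0"
proof -
  have ev: "rpoly f x = rpoly \<Phi> x * rpoly (f div \<Phi>) x + rpoly (f mod \<Phi>) x" for x :: complex
    by (metis mult_div_mod_eq rpoly_mult rpoly_simps(5))
  have "rpoly (f mod \<Phi>) \<xi> = 0"
    using ev[of \<xi>] assms(1) rpoly_\<Phi>_\<xi> by simp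
  moreover have "f mod \<Phi> = 0 \<or> degree (f mod \<Phi>) < p - 1"
    using degree_mod_less[OF \<Phi>_nz, of f] degree_\<Phi> by simp
  ultimately have "f mod \<Phi> = 0"
    using rpoly_degree by blast
  then show ?thesis
    using ev[of "\<xi> ^ n"] rpoly_\<Phi>[OF assms(2)] by simp
qed

lemma rpoly_conjugate_eq:
  assumes "rpoly f \<xi> = rpoly f' \<xi>" "\<not> p dvd n"
  shows "rpoly f (\<xi> ^ n) = rpoly f' (\<xi> ^ n)"
  using rpoly_conjugate[of "f - f'"] assms by simp

text \<open>The gcd \<open>d\<close> of \<open>f\<close> and \<open>\<Phi>\<close> does not vanish
  at \<xi>, so its cofactor in \<open>\<Phi>\<close> does and has full degree. Thus \<open>d\<close>
  is constant, and a Bezout identity gives the inverse.\<close>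

lemma rpoly_inverse:
  assumes "rpoly f \<xi> \<noteq> 0"
  shows "\<exists>f'. rpoly f \<xi> * rpoly f' \<xi> = 1"
proof -
  define d where "d = gcd f \<Phi>"
  have "d dvd f" "d dvd \<Phi>" by (simp_all add: d_def)
  then obtain f1 e where f1: "f = d * f1" and e: "\<Phi> = d * e" by (auto elim!: dvdE)
  have "rpoly d \<xi> \<noteq> 0"
    using assms f1 by auto
  then have "rpoly e \<xi> = 0"
    using rpoly_\<Phi>_\<xi> unfolding e by simp
  moreover have nz: "d \<noteq> 0" "e \<noteq> 0"
    using \<Phi>_nz unfolding e by auto
  ultimately have "degree e \<ge> p - 1"
    using rpoly_degree[of e] by force
  then have "degree d = 0"
    using degree_mult_eq[OF nz] degree_\<Phi> unfolding e by simp
  then obtain c where c: "d = [:c:]"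
    by (rule degree_eq_zeroE)
  have c0: "c \<noteq> 0" using nz c by simp
  obtain a b where ab: "a * f + b * \<Phi> = d"
    using bezout_coefficients_fst_snd[of f \<Phi>] unfolding d_def by blast
  have "rpoly (a * f + b * \<Phi>) \<xi> = of_rat c"
    unfolding ab c by simp
  then have "rpoly a \<xi> * rpoly f \<xi> = of_rat c"
    by (simp add: rpoly_\<Phi>_\<xi>)
  then have "rpoly f \<xi> * rpoly (smult (inverse c) a) \<xi> = 1"
    using c0 by (simp add: mult_ac of_rat_inverse)
  then show ?thesis by blast
qed

text \<open>The field Q(\<xi>); closure under inverses rests on
  \<open>rpoly_inverse\<close>.\<close>

definition Qext :: "complex set" where
  "Qext = range (\<lambda>f. rpoly f \<xi>)"

lemma Qext_subfield: "is_subfield Qext"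
  unfolding is_subfield_def
proof (intro conjI ballI)
  show "0 \<in> Qext" "1 \<in> Qext"
    unfolding Qext_def by (auto intro: range_eqI[of _ _ 0] range_eqI[of _ _ 1])
  fix x assume "x \<in> Qext"
  then obtain f where f: "x = rpoly f \<xi>" by (auto simp: Qext_def)
  show "- x \<in> Qext"
    unfolding Qext_def by (rule range_eqI[of _ _ "- f"]) (simp add: f)
  show "inverse x \<in> Qext"
  proof (cases "x = 0")
    case True
    then show ?thesis using \<open>0 \<in> Qext\<close> by simp
  next
    case False
    then obtain f' where "x * rpoly f' \<xi> = 1"
      using rpoly_inverse f by blast
    then have "inverse x = rpoly f' \<xi>"
      by (rule inverse_unique)
    then show ?thesis by (simp add: Qext_def)
  qed
  fix y assume "y \<in> Qext"
  then obtain f' where f': "y = rpoly f' \<xi>" by (auto simp: Qext_def)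
  show "x + y \<in> Qext"
    unfolding Qext_def by (rule range_eqI[of _ _ "f + f'"]) (simp add: f f')
  show "x * y \<in> Qext"
    unfolding Qext_def by (rule range_eqI[of _ _ "f * f'"]) (simp add: f f')
qed

lemma cyclotomic_subset_Qext: "cyclotomic_field p \<subseteq> Qext"
  unfolding cyclotomic_field_def
proof (rule hull_minimal)
  have "cis (2 * pi / real p) ^ p = 1"
    using p_gt_1 by (simp add: DeMoivre)
  then obtain n where "cis (2 * pi / real p) = \<xi> ^ n"
    using roots_of_unity_powers by blast
  then show "{cis (2 * pi / real p)} \<subseteq> Qext"
    by (auto simp: Qext_def intro!: range_eqI[of _ _ "monom 1 n"])
qed (rule Qext_subfield)

text \<open>The automorphism of Q(\<xi>) sending \<xi> to \<xi>^n. For \<open>n\<close> prime to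
  \<open>p\<close> the choice of polynomial is immaterial by \<open>rpoly_conjugate_eq\<close>;
  outside \<open>Qext\<close> the value is unspecified.\<close>

definition conj :: "nat \<Rightarrow> complex \<Rightarrow> complex" where
  "conj n x = rpoly (SOME f. rpoly f \<xi> = x) (\<xi> ^ n)"

lemma conj_rpoly:
  assumes "\<not> p dvd n"
  shows "conj n (rpoly f \<xi>) = rpoly f (\<xi> ^ n)"
proof -
  have "rpoly (SOME f'. rpoly f' \<xi> = rpoly f \<xi>) \<xi> = rpoly f \<xi>"
    by (rule someI[of _ f]) simp
  then show ?thesis
    unfolding conj_def by (rule rpoly_conjugate_eq[OF _ assms])
qed

lemma conj_rpoly_power:
  assumes "\<not> p dvd n"
  shows "conj n (rpoly f (\<xi> ^ m)) = rpoly f (\<xi> ^ (n * m))"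
  using conj_rpoly[OF assms, of "pcompose f (monom 1 m)"]
  by (simp add: rpoly_pcompose power_mult)

lemma conj_add:
  assumes "\<not> p dvd n" "x \<in> Qext" "y \<in> Qext"
  shows "conj n (x + y) = conj n x + conj n y"
proof -
  obtain f f' where f: "x = rpoly f \<xi>" "y = rpoly f' \<xi>"
    using assms by (auto simp: Qext_def)
  show ?thesis
    using conj_rpoly[OF assms(1), of "f + f'"] unfolding f by (simp add: conj_rpoly[OF assms(1)])
qed

lemma conj_mult:
  assumes "\<not> p dvd n" "x \<in> Qext" "y \<in> Qext"
  shows "conj n (x * y) = conj n x * conj n y"
proof -
  obtain f f' where f: "x = rpoly f \<xi>" "y = rpoly f' \<xi>"
    using assms by (auto simp: Qext_def)
  show ?thesis
    using conj_rpoly[OF assms(1), of "f * f'"] unfolding f by (simp add: conj_rpoly[OF assms(1)])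
qed

lemma conj_of_rat: "\<not> p dvd n \<Longrightarrow> conj n (of_rat q) = of_rat q"
  using conj_rpoly[of n "[:q:]"] by simp

text \<open>The cyclotomic polynomial at 1, once from its factorisation \<open>D\<close> and once
  from its coefficients in \<open>G\<close>.\<close>

lemma prod_one_minus_powers: "(\<Prod>n\<in>{0<..<p}. 1 - \<xi> ^ n) = of_nat p"
proof -
  define D where "D = (\<Prod>n\<in>{0<..<p}. [:- (\<xi> ^ n), 1:])"
  define G :: "complex poly" where "G = (\<Sum>i<p. monom 1 i)"
  have degD: "degree D = p - 1"
    unfolding D_def by (subst degree_prod_sum_eq) auto
  \<comment> \<open>Both are monic of degree \<open>p - 1\<close> and vanish at the
    \<open>p - 1\<close> powers of \<xi> other than 1.\<close>
  have "D = G"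
  proof (rule poly_eqI_degree_lead_coeff[of _ "p - 1" _ "(\<lambda>n. \<xi> ^ n) ` {0<..<p}"])
    have "lead_coeff D = 1"
      unfolding D_def by (simp add: lead_coeff_prod)
    then have "coeff D (p - 1) = 1"
      by (simp only: degD)
    also have "1 = coeff G (p - 1)"
      using p_gt_1 by (simp add: G_def coeff_sum)
    finally show "coeff D (p - 1) = coeff G (p - 1)" .
    have "card ((\<lambda>n. \<xi> ^ n) ` {0<..<p}) = card {0<..<p}"
      by (intro card_image inj_on_subset[OF pow_inj]) auto
    then show "p - 1 \<le> card ((\<lambda>n. \<xi> ^ n) ` {0<..<p})" by simp
    show "degree D \<le> p - 1" by (simp add: degD)
    show "degree G \<le> p - 1"
      unfolding G_def using p_gt_1 by (intro degree_sum_le) (auto simp: degree_monom_eq)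
    fix z assume "z \<in> (\<lambda>n. \<xi> ^ n) ` {0<..<p}"
    then obtain n where n: "0 < n" "n < p" "z = \<xi> ^ n" by auto
    have "poly D z = 0"
      using n by (auto simp: D_def poly_prod)
    moreover have "\<not> p dvd n"
      using n by (auto dest: dvd_imp_le)
    then have "poly G z = 0"
      using n sum_powers[of n] by (simp add: G_def poly_sum poly_monom)
    ultimately show "poly D z = poly G z" by simp
  qed
  then have "poly D 1 = poly G 1" by simp
  then show ?thesis
    by (simp add: D_def G_def poly_prod poly_sum poly_monom)
qed

end

locale cubic_periods = cyclotomic_prime +
  fixes h g :: nat
  assumes p_eq: "p = h * 3 + 1" and primroot: "residue_primroot p g"
begin

text \<open>Exponents are listed by discrete logarithm to the base \<open>g\<close>, so that sending
  \<xi> to \<xi>^g becomes the shift from \<open>k\<close> to \<open>k + 1\<close>.\<close>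

definition e :: "nat \<Rightarrow> complex" where
  "e k = \<xi> ^ (g ^ k)"

text \<open>\<open>per 0\<close> is the Gaussian period, \<open>per 1\<close> and
  \<open>per 2\<close> are its conjugates; the index matters only modulo 3.\<close>

definition per :: "nat \<Rightarrow> complex" where
  "per j = (\<Sum>r<h. e (j + 3 * r))"

lemma h_pos: "h > 0"
  using p_gt_1 p_eq by simp

lemma generator: "bij_betw (\<lambda>k. g ^ k mod p) {..<3 * h} {0<..<p}"
  using residue_primroot_is_generator[OF p_gt_1 primroot] totatives_prime[OF p] totient_prime[OF p] p_eq
  by (simp add: mult.commute)

lemma e_mod: "\<xi> ^ (g ^ k mod p) = e k"
  by (simp add: e_def pow_mod)

lemma g_pow_order: "[g ^ (3 * h) = 1] (mod p)"
proof -
  have "coprime g p"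
    using primroot by (simp add: residue_primroot_def coprime_commute)
  then show ?thesis
    using euler_theorem[of g p] totient_prime[OF p] p_eq by (simp add: mult.commute)
qed

lemma g_not_dvd: "\<not> p dvd g"
proof -
  have "coprime p g"
    using primroot by (simp add: residue_primroot_def)
  then show ?thesis
    using p p_gt_1 by (metis coprime_absorb_left not_prime_unit)
qed

lemma e_period: "e (k + 3 * h) = e k"
  unfolding e_def
proof (rule pow_cong)
  show "[g ^ (k + 3 * h) = g ^ k] (mod p)"
    using cong_mult[OF cong_refl[of "g ^ k"] g_pow_order] by (simp add: power_add)
qed

lemma sum_e: "(\<Sum>k<3 * h. e k) = - 1"
proof -
  have "(\<Sum>k<3 * h. e k) = (\<Sum>n\<in>{0<..<p}. \<xi> ^ n)"
    using sum.reindex_bij_betw[OF generator, of "\<lambda>n. \<xi> ^ n"] by (simp add: e_mod)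
  also have "\<dots> = (\<Sum>n<p. \<xi> ^ n) - 1"
  proof -
    have "{..<p} = insert 0 {0<..<p}"
      using p_gt_1 by auto
    then show ?thesis by simp
  qed
  also have "(\<Sum>n<p. \<xi> ^ n) = 0"
    using sum_powers[of 1] p_gt_1 by simp
  finally show ?thesis by simp
qed

lemma power_cases:
  obtains "p dvd n" | k where "k < 3 * h" "[n = g ^ k] (mod p)"
proof (cases "p dvd n")
  case False
  then have "n mod p \<in> {0<..<p}"
    using p_gt_1 by (auto simp: mod_greater_zero_iff_not_dvd)
  then have "n mod p \<in> (\<lambda>k. g ^ k mod p) ` {..<3 * h}"
    using generator by (simp add: bij_betw_def)
  then obtain k where "k < 3 * h" "n mod p = g ^ k mod p"
    by blast
  then show ?thesis using that by (auto simp: cong_def)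
qed (use that in blast)

lemma per_3: "per (j + 3) = per j"
proof -
  have "per (j + 3) = (\<Sum>r<h. e (j + 3 * (r + 1)))"
    by (simp add: per_def algebra_simps)
  also have "\<dots> = per j"
    unfolding per_def
  proof (rule sum.cyclic_shift[of "\<lambda>r. e (j + 3 * r)" h 1])
    show "e (j + 3 * (r + h)) = e (j + 3 * r)" for r
      using e_period[of "j + 3 * r"] by (simp add: algebra_simps)
  qed
  finally show ?thesis .
qed

lemma per_mod: "per j = per (j mod 3)"
proof (induction j rule: less_induct)
  case (less j)
  show ?case
  proof (cases "j < 3")
    case False
    then have "per j = per (j - 3)"
      using per_3[of "j - 3"] by simp
    also have "\<dots> = per ((j - 3) mod 3)"
      by (rule less) (use False in simp)
    also have "(j - 3) mod 3 = j mod 3"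
      using False by (simp add: le_mod_geq)
    finally show ?thesis .
  qed simp
qed

lemma per_cases: "per j = per 0 \<or> per j = per 1 \<or> per j = per 2"
proof -
  have "j mod 3 = 0 \<or> j mod 3 = 1 \<or> j mod 3 = 2" by auto
  then show ?thesis using per_mod[of j] by metis
qed

lemma per_sum: "per 0 + per 1 + per 2 = - 1"
  using sum_e unfolding sum.residues_mod_3 by (simp add: per_def)

text \<open>The trace of \<xi>^m from Q(\<xi>) to its cubic subfield: \<open>h\<close> if
  \<open>p\<close> divides \<open>m\<close>, and a period otherwise.\<close>

definition orbit_sum :: "nat \<Rightarrow> complex" where
  "orbit_sum m = (\<Sum>r<h. \<xi> ^ (m * g ^ (3 * r)))"

lemma orbit_sum_cong: "[m = n] (mod p) \<Longrightarrow> orbit_sum m = orbit_sum n"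
  unfolding orbit_sum_def by (intro sum.cong refl pow_cong cong_mult cong_refl)

lemma orbit_sum_power: "orbit_sum (g ^ k) = per k"
  by (simp add: orbit_sum_def per_def e_def power_add)

lemma orbit_sum_cases: "orbit_sum m = of_nat h \<or> (\<exists>k. orbit_sum m = per k)"
proof (cases m rule: power_cases)
  case 1
  then have "orbit_sum m = orbit_sum 0"
    by (intro orbit_sum_cong) (simp add: cong_0_iff)
  then show ?thesis by (simp add: orbit_sum_def)
next
  case (2 k)
  then show ?thesis
    using orbit_sum_cong orbit_sum_power by metis
qed

text \<open>Shifting the inner index by \<open>s\<close> lets \<open>g^(3 s)\<close> be factored out
  of the exponent, and the sum over \<open>s\<close> becomes an orbit sum. Hence products of periods
  are integral combinations of periods.\<close>

lemma per_mult: "per i * per j = (\<Sum>t<h. orbit_sum (g ^ (i + 3 * t) + g ^ j))"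
proof -
  have "per i * per j = (\<Sum>s<h. per i * e (j + 3 * s))"
    by (simp add: per_def[of j] sum_distrib_left)
  also have "\<dots> = (\<Sum>s<h. (\<Sum>t<h. e (i + 3 * (t + s))) * e (j + 3 * s))"
  proof -
    have "(\<Sum>t<h. e (i + 3 * (t + s))) = per i" for s
      unfolding per_def
    proof (rule sum.cyclic_shift[of "\<lambda>r. e (i + 3 * r)" h s])
      show "e (i + 3 * (r + h)) = e (i + 3 * r)" for r
        using e_period[of "i + 3 * r"] by (simp add: algebra_simps)
    qed
    then show ?thesis by simp
  qed
  also have "\<dots> = (\<Sum>s<h. \<Sum>t<h. \<xi> ^ ((g ^ (i + 3 * t) + g ^ j) * g ^ (3 * s)))"
    by (simp add: sum_distrib_right e_def add_mult_distrib flip: power_add)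
      (simp add: power_add add_mult_distrib mult_ac)
  also have "\<dots> = (\<Sum>t<h. orbit_sum (g ^ (i + 3 * t) + g ^ j))"
    unfolding orbit_sum_def by (rule sum.swap)
  finally show ?thesis .
qed

section \<open>The ring spanned by the periods\<close>

definition R :: "complex set" where
  "R = {of_int a * per 0 + of_int b * per 1 + of_int c * per 2 | a b c. True}"

lemma R_I: "of_int a * per 0 + of_int b * per 1 + of_int c * per 2 \<in> R"
  by (auto simp: R_def)

lemma R_E:
  assumes "x \<in> R"
  obtains a b c where "x = of_int a * per 0 + of_int b * per 1 + of_int c * per 2"
  using assms by (auto simp: R_def)

lemma R_diff:
  assumes "x \<in> R" "y \<in> R"
  shows "x - y \<in> R"
proof -
  obtain a b c where x: "x = of_int a * per 0 + of_int b * per 1 + of_int c * per 2"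
    using R_E[OF assms(1)] .
  obtain a' b' c' where y: "y = of_int a' * per 0 + of_int b' * per 1 + of_int c' * per 2"
    using R_E[OF assms(2)] .
  have "x - y = of_int (a - a') * per 0 + of_int (b - b') * per 1 + of_int (c - c') * per 2"
    unfolding x y by (simp add: algebra_simps)
  then show ?thesis by (simp only: R_I)
qed

lemma R_0: "0 \<in> R"
  using R_I[of 0 0 0] by simp

lemma R_add:
  assumes "x \<in> R" "y \<in> R"
  shows "x + y \<in> R"
  using R_diff[OF assms(1) R_diff[OF R_0 assms(2)]] by simp

lemma R_sum: "(\<And>i. i \<in> A \<Longrightarrow> f i \<in> R) \<Longrightarrow> sum f A \<in> R"
  by (induction A rule: infinite_finite_induct) (auto intro: R_add R_0)

lemma R_of_int_mult:
  assumes "x \<in> R"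
  shows "of_int n * x \<in> R"
proof -
  obtain a b c where x: "x = of_int a * per 0 + of_int b * per 1 + of_int c * per 2"
    using R_E[OF assms(1)] .
  have "of_int n * x = of_int (n * a) * per 0 + of_int (n * b) * per 1 + of_int (n * c) * per 2"
    unfolding x by (simp add: algebra_simps)
  then show ?thesis by (simp only: R_I)
qed

lemma R_1: "1 \<in> R"
proof -
  have "1 = - (per 0 + per 1 + per 2)"
    by (simp only: per_sum minus_minus)
  also have "\<dots> = of_int (- 1) * per 0 + of_int (- 1) * per 1 + of_int (- 1) * per 2"
    by simp
  finally show ?thesis by (rule ssubst) (rule R_I)
qed

lemma R_per: "per j \<in> R"
  using per_cases[of j] R_I[of 1 0 0] R_I[of 0 1 0] R_I[of 0 0 1] by auto

lemma R_orbit_sum: "orbit_sum m \<in> R"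
  using orbit_sum_cases[of m] R_of_int_mult[OF R_1, of "int h"] R_per by auto

lemma R_mult:
  assumes "x \<in> R" "y \<in> R"
  shows "x * y \<in> R"
proof -
  have per: "per i * per j \<in> R" for i j
    unfolding per_mult by (intro R_sum R_orbit_sum)
  obtain a b c where y: "y = of_int a * per 0 + of_int b * per 1 + of_int c * per 2"
    using R_E[OF assms(2)] .
  have per': "per i * y \<in> R" for i
  proof -
    have "per i * y = of_int a * (per i * per 0) + of_int b * (per i * per 1) + of_int c * (per i * per 2)"
      by (simp add: y algebra_simps)
    then show ?thesis by (simp add: R_add R_of_int_mult per)
  qed
  obtain a b c where x: "x = of_int a * per 0 + of_int b * per 1 + of_int c * per 2"
    using R_E[OF assms(1)] .
  have "x * y = of_int a * (per 0 * y) + of_int b * (per 1 * y) + of_int c * (per 2 * y)"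
    by (simp add: x algebra_simps)
  then show ?thesis by (simp add: R_add R_of_int_mult per')
qed

text \<open>The cubic subfield of Q(\<xi>), as a rational subspace.\<close>

abbreviation K :: "complex set" where
  "K \<equiv> rat_vs.span {per 0, per 1, per 2}"

lemma K_orbit_sum: "orbit_sum m \<in> K"
proof -
  obtain a b c where "orbit_sum m = of_int a * per 0 + of_int b * per 1 + of_int c * per 2"
    using R_E[OF R_orbit_sum] .
  then have "orbit_sum m = of_rat (of_int a) * per 0 + of_rat (of_int b) * per 1 + of_rat (of_int c) * per 2"
    by simp
  then show ?thesis unfolding span3_iff by blast
qed

text \<open>An invariant element is its own average over the subgroup of index 3.\<close>

lemma K_invariant:
  assumes "\<And>r. r < h \<Longrightarrow> rpoly f (\<xi> ^ (g ^ (3 * r))) = rpoly f \<xi>"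
  shows "rpoly f \<xi> \<in> K"
proof -
  have "of_nat h * rpoly f \<xi> = (\<Sum>r<h. rpoly f (\<xi> ^ (g ^ (3 * r))))"
    using assms by simp
  also have "\<dots> = (\<Sum>r<h. \<Sum>i\<le>degree f. of_rat (coeff f i) * \<xi> ^ (i * g ^ (3 * r)))"
    by (simp add: rpoly_altdef mult.commute flip: power_mult)
  also have "\<dots> = (\<Sum>i\<le>degree f. of_rat (coeff f i) * orbit_sum i)"
    unfolding orbit_sum_def sum_distrib_left by (rule sum.swap)
  also have "\<dots> \<in> K"
    by (intro rat_vs.span_sum)
      (use rat_vs.span_scale[OF K_orbit_sum] in \<open>simp add: rat_scale_complex\<close>)
  finally have "rat_scale (1 / of_nat h) (of_nat h * rpoly f \<xi>) \<in> K"
    by (rule rat_vs.span_scale)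
  then show ?thesis
    using h_pos by (simp add: rat_scale_complex of_rat_divide)
qed

text \<open>The \<open>e k\<close> are \<xi>, ..., \<xi>^(p-1) in another order. A relation divided
  by \<xi> is a polynomial of degree below \<open>p - 1\<close> vanishing at \<xi>, hence
  zero.\<close>

lemma e_independent:
  assumes "(\<Sum>k<3 * h. of_rat (c k) * e k) = 0" "k < 3 * h"
  shows "c k = 0"
proof -
  define ex where "ex k = g ^ k mod p" for k
  have ex: "ex k > 0" "ex k < p" if "k < 3 * h" for k
    using that bij_betwE[OF generator] by (auto simp: ex_def)
  \<comment> \<open>As \<open>ex k\<close> lies between 1 and \<open>p - 1\<close>, the subtraction
    does not truncate and the degree is at most \<open>p - 2\<close>.\<close>
  define f where "f = (\<Sum>k<3 * h. monom (c k) (ex k - 1))"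
  have "\<xi> * rpoly f \<xi> = (\<Sum>k<3 * h. of_rat (c k) * e k)"
  proof -
    have eq: "\<xi> * (of_rat (c k) * \<xi> ^ (ex k - 1)) = of_rat (c k) * e k" if "k < 3 * h" for k
    proof -
      have "\<xi> * \<xi> ^ (ex k - 1) = \<xi> ^ ex k"
        using ex[OF that] by (simp flip: power_Suc)
      then show ?thesis by (simp add: ex_def e_mod)
    qed
    then show ?thesis
      unfolding f_def rpoly_sum sum_distrib_left rpoly_simps by (intro sum.cong[OF refl] eq) simp
  qed
  moreover have "\<xi> \<noteq> 0"
    using \<xi>_p p_gt_1 by (auto simp: zero_power)
  ultimately have "rpoly f \<xi> = 0" using assms by simp
  moreover have "degree f < p - 1"
    unfolding f_def
  proof (rule degree_sum_less)
    fix k assume "k \<in> {..<3 * h}"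
    then have "ex k - 1 < p - 1" using ex[of k] by auto
    then show "degree (monom (c k) (ex k - 1)) < p - 1"
      using degree_monom_le[of "c k" "ex k - 1"] by simp
  qed (use p_gt_1 in simp)
  ultimately have f0: "f = 0" by (rule rpoly_degree)
  have inj: "ex j - 1 = ex k - 1 \<longleftrightarrow> j = k" if "j < 3 * h" for j
  proof -
    have "ex j = ex k \<longleftrightarrow> j = k"
      using generator that assms(2) unfolding bij_betw_def inj_on_def ex_def by auto
    then show ?thesis using ex[OF that] ex[OF assms(2)] by auto
  qed
  have "coeff f (ex k - 1) = (\<Sum>j<3 * h. if j = k then c j else 0)"
    unfolding f_def coeff_sum by (intro sum.cong refl) (simp only: coeff_monom inj lessThan_iff)
  then show ?thesis
    using assms(2) by (simp add: f0)
qed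

text \<open>The \<open>e k\<close> span Z[\<xi>] over the integers: 1 is minus their sum, and every
  other power of \<xi> is one of them.\<close>

lemma int_poly_e:
  fixes F :: "int poly"
  shows "\<exists>b :: nat \<Rightarrow> int. poly (map_poly of_int F) \<xi> = (\<Sum>k<3 * h. of_int (b k) * e k)"
proof -
  define E where "E = {(\<Sum>k<3 * h. of_int (b k) * e k) | b :: nat \<Rightarrow> int. True}"
  have E_I: "(\<Sum>k<3 * h. of_int (b k) * e k) \<in> E" for b
    unfolding E_def by blast
  have E_add: "x + y \<in> E" if x: "x \<in> E" and y: "y \<in> E" for x y
  proof -
    obtain b b' where "x = (\<Sum>k<3 * h. of_int (b k) * e k)" "y = (\<Sum>k<3 * h. of_int (b' k) * e k)"
      using x y unfolding E_def by blast
    then have "x + y = (\<Sum>k<3 * h. of_int (b k + b' k) * e k)"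
      by (simp add: distrib_right sum.distrib)
    then show ?thesis using E_I[of "\<lambda>k. b k + b' k"] by simp
  qed
  have E_mult: "of_int n * x \<in> E" if x: "x \<in> E" for n x
  proof -
    obtain b where "x = (\<Sum>k<3 * h. of_int (b k) * e k)"
      using x unfolding E_def by blast
    then have "of_int n * x = (\<Sum>k<3 * h. of_int (n * b k) * e k)"
      by (simp add: sum_distrib_left mult.assoc)
    then show ?thesis using E_I[of "\<lambda>k. n * b k"] by simp
  qed
  have E_pow: "\<xi> ^ n \<in> E" for n
  proof (cases n rule: power_cases)
    case 1
    then have "\<xi> ^ n = - (\<Sum>k<3 * h. e k)"
      using sum_e pow_eq_1_iff by simp
    also have "\<dots> = (\<Sum>k<3 * h. of_int (- 1) * e k)"
      by (simp add: sum_negf)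
    finally show ?thesis using E_I[of "\<lambda>_. - 1"] by simp
  next
    case (2 k)
    have "\<xi> ^ n = e k"
      unfolding e_def by (rule pow_cong[OF 2(2)])
    also have "\<dots> = (\<Sum>j<3 * h. if j = k then e j else 0)"
      using 2(1) by simp
    also have "\<dots> = (\<Sum>j<3 * h. of_int (if j = k then 1 else 0) * e j)"
      by (intro sum.cong) auto
    finally show ?thesis using E_I[of "\<lambda>j. if j = k then 1 else 0"] by simp
  qed
  have E_0: "0 \<in> E" using E_I[of "\<lambda>_. 0"] by simp
  have E_sum: "sum f A \<in> E" if "\<And>i. i \<in> A \<Longrightarrow> f i \<in> E" for f and A :: "nat set"
    using that by (induction A rule: infinite_finite_induct) (auto intro: E_add E_0)
  have "poly (map_poly of_int F) \<xi> \<in> E"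
    unfolding poly_altdef by (intro E_sum) (simp add: E_mult E_pow)
  then show ?thesis unfolding E_def by blast
qed

definition beta :: "nat \<Rightarrow> complex" where
  "beta j = (\<Prod>r<h. 1 - e (j + 3 * r))"

text \<open>Invariance under shifts by 3 gives rational coordinates with respect to the periods;
  being an integral polynomial in \<xi> gives integral coordinates with respect to the
  \<open>e k\<close>. Independence of the \<open>e k\<close> makes the two agree.\<close>

lemma beta_R: "beta j \<in> R"
proof -
  define F :: "int poly" where "F = (\<Prod>r<h. 1 - monom 1 (g ^ (j + 3 * r)))"
  have F: "poly (map_poly of_int F) x = (\<Prod>r<h. 1 - x ^ (g ^ (j + 3 * r)))" for x :: complex
    by (simp add: F_def of_int_poly_hom.hom_prod of_int_poly_hom.hom_minus poly_prod poly_monom)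
  have beta: "beta j = poly (map_poly of_int F) \<xi>"
    by (simp add: F beta_def e_def)
  define f :: "rat poly" where "f = map_poly of_int F"
  have f: "rpoly f x = poly (map_poly of_int F) x" for x :: complex
    by (simp add: f_def rpoly_of_int_poly)
  have "rpoly f (\<xi> ^ (g ^ (3 * s))) = rpoly f \<xi>" for s
  proof -
    have "rpoly f (\<xi> ^ (g ^ (3 * s))) = (\<Prod>r<h. 1 - e (j + 3 * (r + s)))"
      unfolding f F e_def by (simp add: power_add add_mult_distrib2 mult_ac flip: power_mult)
    also have "\<dots> = (\<Prod>r<h. 1 - e (j + 3 * r))"
    proof (rule prod.cyclic_shift[of "\<lambda>r. 1 - e (j + 3 * r)" h s])
      show "1 - e (j + 3 * (r + h)) = 1 - e (j + 3 * r)" for r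
        using e_period[of "j + 3 * r"] by (simp add: algebra_simps)
    qed
    finally show ?thesis
      by (simp add: f F e_def)
  qed
  then have "beta j \<in> K"
    using K_invariant[of f] by (simp add: beta f)
  then obtain a0 a1 a2 where a: "beta j = of_rat a0 * per 0 + of_rat a1 * per 1 + of_rat a2 * per 2"
    unfolding span3_iff by blast
  \<comment> \<open>The coordinates with respect to the periods are spread over the
    \<open>e k\<close> by residue modulo 3; they are read back at
    \<open>k = 0, 1, 2\<close>.\<close>
  define a where "a k = (if k mod 3 = 0 then a0 else if k mod 3 = 1 then a1 else a2)" for k :: nat
  have "(1 + 3 * r) mod 3 = 1" "(2 + 3 * r) mod 3 = 2" for r :: nat
    by presburger+
  then have "a (3 * r) = a0" "a (1 + 3 * r) = a1" "a (2 + 3 * r) = a2" for r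
    unfolding a_def by simp_all
  then have "beta j = (\<Sum>k<3 * h. of_rat (a k) * e k)"
    unfolding sum.residues_mod_3 a per_def sum_distrib_left by simp
  moreover obtain b where "beta j = (\<Sum>k<3 * h. of_int (b k) * e k)"
    using int_poly_e[of F] beta by auto
  ultimately have "(\<Sum>k<3 * h. of_rat (a k - of_int (b k)) * e k) = 0"
    by (simp add: of_rat_diff left_diff_distrib sum_subtractf)
  then have "a k = of_int (b k)" if "k < 3 * h" for k
    using e_independent[of "\<lambda>k. a k - of_int (b k)" k] that by simp
  from this[of 0] this[of 1] this[of 2] have "a0 = of_int (b 0)" "a1 = of_int (b 1)" "a2 = of_int (b 2)"
    using h_pos by (auto simp: a_def)
  then show ?thesis
    using R_I[of "b 0" "b 1" "b 2"] by (simp add: a)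
qed

text \<open>The norm of \<beta>: the three products together run once through
  \<open>1 - \<xi> ^ n\<close> for \<open>0 < n < p\<close>.\<close>

lemma beta_prod: "beta 0 * beta 1 * beta 2 = of_nat p"
proof -
  have "beta 0 * beta 1 * beta 2 = (\<Prod>k<3 * h. 1 - e k)"
    unfolding prod.residues_mod_3 by (simp add: beta_def)
  also have "\<dots> = (\<Prod>n\<in>{0<..<p}. 1 - \<xi> ^ n)"
    using prod.reindex_bij_betw[OF generator, of "\<lambda>n. 1 - \<xi> ^ n"] by (simp add: e_mod)
  finally show ?thesis by (simp add: prod_one_minus_powers)
qed

lemma conj_per: "conj g (per j) = per (j + 1)"
proof -
  have "per j = rpoly (\<Sum>r<h. monom 1 (g ^ (j + 3 * r))) \<xi>"
    by (simp add: per_def e_def rpoly_sum)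
  then have "conj g (per j) = rpoly (\<Sum>r<h. monom 1 (g ^ (j + 3 * r))) (\<xi> ^ g)"
    using conj_rpoly[OF g_not_dvd] by simp
  also have "\<dots> = per (j + 1)"
    by (simp add: per_def e_def rpoly_sum flip: power_mult)
  finally show ?thesis .
qed

end

section \<open>The field \<open>Z\<close> and the action of \<open>S\<close> on the periods\<close>

locale cubic_subfield = cubic_periods + cyclic_cubic +
  assumes Z_cyclotomic: "Z \<subseteq> cyclotomic_field p"
begin

lemma Z_Qext: "Z \<subseteq> Qext"
  using Z_cyclotomic cyclotomic_subset_Qext by blast

lemma conj_power_S:
  obtains i where "i < 3" "\<And>z. z \<in> Z \<Longrightarrow> conj g z = (S ^^ i) z"
  using embedding_is_power[of "conj g"] conj_add[OF g_not_dvd] conj_mult[OF g_not_dvd]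
    conj_of_rat[OF g_not_dvd] Z_Qext by (metis subsetD)

lemma S_power_in: "z \<in> Z \<Longrightarrow> (S ^^ i) z \<in> Z"
  by (induction i) (auto simp: S_in)

lemma S_power_cube:
  assumes "z \<in> Z"
  shows "(S ^^ (3 * n)) z = z"
proof (induction n)
  case (Suc n)
  have "3 * Suc n = Suc (Suc (Suc (3 * n)))" by simp
  then show ?case
    using Suc S_cube[OF assms] by (simp only: funpow.simps o_apply)
qed simp

lemma Z_subset_K: "Z \<subseteq> K"
proof
  fix z assume z: "z \<in> Z"
  obtain i where i: "\<And>z. z \<in> Z \<Longrightarrow> conj g z = (S ^^ i) z"
    using conj_power_S by metis
  obtain f where f: "z = rpoly f \<xi>"
    using z Z_Qext by (auto simp: Qext_def)
  \<comment> \<open>Iterating \<open>conj g\<close> substitutes \<xi>^(g^k) for \<xi>, while on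
    \<open>Z\<close> it iterates \<open>S ^^ i\<close>; for \<open>k\<close> a multiple of 3 the
    latter is trivial.\<close>
  have conj_iter: "rpoly f (\<xi> ^ (g ^ k)) = (S ^^ (i * k)) z" for k
  proof (induction k)
    case (Suc k)
    have "rpoly f (\<xi> ^ (g ^ Suc k)) = conj g (rpoly f (\<xi> ^ (g ^ k)))"
      using conj_rpoly_power[OF g_not_dvd, of f "g ^ k"] by simp
    also have "\<dots> = (S ^^ i) ((S ^^ (i * k)) z)"
      unfolding Suc by (rule i[OF S_power_in[OF z]])
    finally show ?case by (simp add: funpow_add)
  qed (simp add: f)
  have "rpoly f (\<xi> ^ (g ^ (3 * r))) = rpoly f \<xi>" for r
    unfolding conj_iter f[symmetric] using S_power_cube[OF z, of "i * r"] by (simp add: mult_ac)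
  then show "z \<in> K"
    unfolding f by (rule K_invariant)
qed

lemma per_Z: "per j \<in> Z"
  using spanning_triple(1)[OF Z_subset_K] per_cases[of j] by auto

lemma per_distinct: "per 0 \<noteq> per 1"
proof
  assume "per 0 = per 1"
  then have "card {per 0, per 1, per 2} \<le> 2"
    by (simp add: card_insert_if)
  then show False
    using spanning_triple(2)[OF Z_subset_K] by simp
qed

text \<open>\<open>S\<close> is prescribed independently of \<open>g\<close>, so
  \<open>conj g\<close> restricts to \<open>S\<close> or to its inverse \<open>S^2\<close>; the
  exponent 0 is excluded since the periods are distinct. In the second case \<open>S\<close> shifts
  by 2, because \<open>S^3 = 1\<close>.\<close>

lemma S_per: "(\<forall>j. S (per j) = per (j + 1)) \<or> (\<forall>j. S (per j) = per (j + 2))"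
proof -
  obtain i where i: "i < 3" "\<And>z. z \<in> Z \<Longrightarrow> conj g z = (S ^^ i) z"
    using conj_power_S by metis
  have per: "per (j + 1) = (S ^^ i) (per j)" for j
    using i(2)[OF per_Z] conj_per by metis
  have "i \<noteq> 0"
  proof
    assume "i = 0"
    then show False using per[of 0] per_distinct by simp
  qed
  then consider "i = 1" | "i = 2" using i(1) by linarith
  then show ?thesis
  proof cases
    case 1
    then show ?thesis using per by simp
  next
    case 2
    then have S2: "S (S (per j)) = per (j + 1)" for j
      using per[of j] by (simp add: numeral_2_eq_2)
    have "S (per j) = per (j + 2)" for j
    proof -
      have "per (j + 3) = S (S (per (j + 2)))"
        using S2[of "j + 2"] by (simp add: numeral_3_eq_3)
      then have "S (per j) = S (S (S (per (j + 2))))"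
        by (simp add: per_3)
      then show ?thesis
        using S_cube[OF per_Z] by simp
    qed
    then show ?thesis by blast
  qed
qed

end

section \<open>The period ring and the associated order\<close>

context cubic_subfield
begin

lemma R_subset_Z: "R \<subseteq> Z"
proof
  fix x assume "x \<in> R"
  then obtain a b c where "x = of_int a * per 0 + of_int b * per 1 + of_int c * per 2"
    by (rule R_E)
  then show "x \<in> Z"
    by (simp only: Z_add Z_mult Z_of_int per_Z)
qed

lemma S_of_int: "S (of_int n) = of_int n"
  using S_of_rat[of "of_int n"] by simp

lemma S_linear:
  assumes "x \<in> Z" "y \<in> Z" "z \<in> Z"
  shows "S (of_int a * x + of_int b * y + of_int c * z) = of_int a * S x + of_int b * S y + of_int c * S z"
  using assms by (simp only: S_add S_mult S_of_int Z_add Z_mult Z_of_int)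

lemma S_R:
  assumes "x \<in> R"
  shows "S x \<in> R"
proof -
  obtain a b c where x: "x = of_int a * per 0 + of_int b * per 1 + of_int c * per 2"
    using R_E[OF assms] .
  have "S (per j) \<in> R" for j
    using S_per R_per by auto
  then show ?thesis
    unfolding x S_linear[OF per_Z per_Z per_Z] by (intro R_add R_of_int_mult)
qed

lemma per_consecutive_sum: "per j + per (j + 1) + per (j + 2) = - 1"
proof (induction j)
  case 0
  show ?case using per_sum by (simp add: numeral_2_eq_2)
next
  case (Suc j)
  have "per (Suc j + 2) = per j"
    using per_3[of j] by (simp add: numeral_3_eq_3)
  then show ?case
    using Suc by (simp add: add_ac)
qed

lemma S_S_per:
  "(\<forall>j. S (per j) = per (j + 1) \<and> S (S (per j)) = per (j + 2)) \<or>
   (\<forall>j. S (per j) = per (j + 2) \<and> S (S (per j)) = per (j + 1))"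
proof -
  have "per (j + 2 + 2) = per (j + 1)" for j
    using per_3[of "j + 1"] by (simp add: eval_nat_numeral)
  then show ?thesis
    using S_per by (auto simp: eval_nat_numeral)
qed

lemma trace_per: "per j + S (per j) + S (S (per j)) = - 1"
proof -
  consider (1) "S (per j) = per (j + 1)" "S (S (per j)) = per (j + 2)"
    | (2) "S (per j) = per (j + 2)" "S (S (per j)) = per (j + 1)"
    using S_S_per by blast
  then show ?thesis
  proof cases
    case 1
    show ?thesis
      unfolding 1(2) unfolding 1(1) by (rule per_consecutive_sum)
  next
    case 2
    show ?thesis
      unfolding 2(2) unfolding 2(1) using per_consecutive_sum[of j] by (simp add: add_ac)
  qed
qed

lemma trace_R:
  assumes "x \<in> R"
  obtains n :: int where "x + S x + S (S x) = of_int n"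
proof -
  obtain a b c where x: "x = of_int a * per 0 + of_int b * per 1 + of_int c * per 2"
    using R_E[OF assms] .
  have "x + S x + S (S x) = of_int a * (per 0 + S (per 0) + S (S (per 0))) +
      of_int b * (per 1 + S (per 1) + S (S (per 1))) + of_int c * (per 2 + S (per 2) + S (S (per 2)))"
    unfolding x S_linear[OF per_Z per_Z per_Z] S_linear[OF S_in[OF per_Z] S_in[OF per_Z] S_in[OF per_Z]]
    by (simp add: algebra_simps)
  also have "\<dots> = of_int (- a - b - c)"
    unfolding trace_per by simp
  finally show ?thesis by (rule that)
qed

text \<open>Both are the trace equation solved for \<open>x\<close>: with \<open>w = - S x\<close>,
  and with \<open>w = - S (S x)\<close> using \<open>S^3 = 1\<close>.\<close>

lemma trace_decomposition:
  assumes "x \<in> R"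
  shows "\<exists>n w. w \<in> R \<and> x = of_int n + w + S w" "\<exists>n w. w \<in> R \<and> x = of_int n + w + S (S w)"
proof -
  obtain n where n: "x + S x + S (S x) = of_int n"
    using trace_R[OF assms] .
  have x: "x \<in> Z" "S x \<in> Z" "S (S x) \<in> Z"
    using assms R_subset_Z S_in by auto
  have S_uminus: "S (- y) = - S y" if "y \<in> Z" for y
    using S_mult[of "of_int (- 1)" y] that S_of_int[of "- 1"] Z_of_int[of "- 1"] by simp
  have mem: "- S x \<in> R" "- S (S x) \<in> R"
    using R_of_int_mult[of _ "- 1"] S_R assms by auto
  have "x = of_int n + (- S x) + S (- S x)"
    using n x by (simp add: S_uminus algebra_simps)
  then show "\<exists>n w. w \<in> R \<and> x = of_int n + w + S w"
    using mem by blast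
  have "S (S (- S (S x))) = - S x"
    using x by (simp add: S_uminus S_cube S_in)
  then have "x = of_int n + (- S (S x)) + S (S (- S (S x)))"
    using n by (simp add: algebra_simps)
  then show "\<exists>n w. w \<in> R \<and> x = of_int n + w + S (S w)"
    using mem by blast
qed

text \<open>\<open>order_I\<close> lists the conjugates by powers of \<open>S\<close>,
  \<open>R\<close> lists them by powers of \<open>g\<close>; the two lists differ at most by a swap
  of the last two.\<close>

lemma R_conjugates:
  "R = {of_int a * per 0 + of_int b * S (per 0) + of_int c * S (S (per 0)) | a b c. True}"
proof -
  have "of_int a * per 0 + of_int b * per 2 + of_int c * per 1 \<in> R" for a b c
    using R_I[of a c b] by (simp add: add_ac)
  moreover have "\<exists>a' b' c'. of_int a * per 0 + of_int b * per 1 + of_int c * per 2 =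
      of_int a' * per 0 + of_int b' * per 2 + of_int c' * per 1" for a b c
    by (rule exI[of _ a], rule exI[of _ c], rule exI[of _ b]) simp
  ultimately have "R = {of_int a * per 0 + of_int b * per 2 + of_int c * per 1 | a b c. True}"
    unfolding R_def by blast
  note swapped = this
  consider (1) "S (per 0) = per 1" "S (S (per 0)) = per 2"
    | (2) "S (per 0) = per 2" "S (S (per 0)) = per 1"
    using S_S_per by (metis add_0)
  then show ?thesis
  proof cases
    case 1
    show ?thesis
      unfolding 1(2) unfolding 1(1) by (rule R_def)
  next
    case 2
    show ?thesis
      unfolding 2(2) unfolding 2(1) by (rule swapped)
  qed
qed

end

theorem theorem3:
  fixes \<sigma> :: int and Z :: "complex set" and S :: "complex \<Rightarrow> complex"
    and \<iota> :: "complex \<Rightarrow> 'a :: {division_ring, ring_char_0}" and u :: 'a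
    and p r :: nat and \<mm> :: "'a set" and C :: "'a mat"
  assumes "canonical_generation 3 \<sigma> Z S \<iota> u p"
    and "associated_maximal_order 3 \<sigma> S \<iota> u p \<mm>"
    and "[\<sigma> = 1] (mod 2)"
    and "r \<ge> 2"
    and "C \<in> matrices_over r \<mm>"
  shows "sum_of_squares_in r (matrices_over r \<mm>) C"
proof -
  have gen: "cyclic_generation 3 (of_int \<sigma>) Z S \<iota> u" "prime p" "has_conductor Z p"
    using assms(1) by (auto simp: canonical_generation_def)
  obtain h g \<xi> l y where mo: "p = h * 3 + 1" "residue_primroot p g" "\<xi> ^ p = 1"
    "\<forall>k. 0 < k \<and> k < p \<longrightarrow> \<xi> ^ k \<noteq> 1"
    "of_nat p * y = (of_int l - u) * \<iota> (period_beta 3 h g \<xi> ^ 2)"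
    "\<mm> = order_I 3 S \<iota> (gauss_period 3 h g \<xi>) y"
    using assms(2) by (auto simp: associated_maximal_order_def)
  have "\<xi> \<noteq> 1"
    using mo(4)[rule_format, of 1] prime_gt_1_nat[OF gen(2)] by auto
  then interpret cubic_subfield p \<xi> h g Z S
    using gen mo by unfold_locales (auto simp: cyclic_generation_def has_conductor_def)
  have \<iota>: "\<iota> 1 = 1" "\<And>x y. x \<in> Z \<Longrightarrow> y \<in> Z \<Longrightarrow> \<iota> (x + y) = \<iota> x + \<iota> y"
    "\<And>x y. x \<in> Z \<Longrightarrow> y \<in> Z \<Longrightarrow> \<iota> (x * y) = \<iota> x * \<iota> y" "\<And>z. z \<in> Z \<Longrightarrow> \<iota> z * u = u * \<iota> (S z)"
    "u ^ 3 = rat_scale (of_int \<sigma>) 1"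
    using gen(1) by (auto simp: cyclic_generation_def)
  have "odd \<sigma>"
    using assms(3) by (metis cong_dvd_iff odd_one)
  have "odd p"
  proof
    assume "even p"
    then have "p = 2"
      using gen(2) primes_dvd_imp_eq two_is_prime_nat by blast
    then show False using mo(1) by presburger
  qed
  have beta: "period_beta 3 h g \<xi> = beta 0" and per: "gauss_period 3 h g \<xi> = per 0"
    by (simp_all add: period_beta_def beta_def gauss_period_def per_def e_def)
  \<comment> \<open>The exponent 2 is \<open>n - 1\<close>; \<open>beta_prod\<close> squared
    supplies the condition on \<open>\<alpha> * \<gamma>\<close>.\<close>
  interpret ord: cubic_crossed_order R S \<iota> u y \<sigma> l p "beta 0 ^ 2" "(beta 1 * beta 2) ^ 2"
  proof unfold_locales
    show "of_nat p * y = (of_int l - u) * \<iota> (beta 0 ^ 2)"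
      using mo(5) by (simp add: beta)
    show "beta 0 ^ 2 * (beta 1 * beta 2) ^ 2 = of_nat p ^ 2"
      using beta_prod by (simp add: mult.assoc flip: power_mult_distrib)
    show "u * (u * u) = of_int \<sigma>"
      using \<iota>(5) by (simp add: rat_scale_def power3_eq_cube mult.assoc)
    show "S 1 = 1"
      using S_of_int[of 1] by simp
  qed (use \<iota> R_subset_Z S_add S_mult trace_decomposition \<open>odd \<sigma>\<close> \<open>odd p\<close> in
      \<open>auto intro!: R_1 R_diff R_mult S_R beta_R simp: power2_eq_square subset_iff\<close>)
  have \<mm>: "\<mm> = ord.order_set"
  proof -
    define \<eta> where "\<eta> = per 0"
    have \<eta>: "\<eta> \<in> Z" "S \<eta> \<in> Z" "S (S \<eta>) \<in> Z"
      using per_Z S_in by (auto simp: \<eta>_def)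
    \<comment> \<open>\<open>z d\<close> is the element of \<open>R\<close> with coordinates
      \<open>d\<close> in the basis of conjugates; it absorbs the inner sum of
      \<open>order_I\<close>.\<close>
    define z where "z d = (\<Sum>k<3. of_int (d k) * (S ^^ k) \<eta>)" for d :: "nat \<Rightarrow> int"
    have z3: "z d = of_int (d 0) * \<eta> + of_int (d 1) * S \<eta> + of_int (d 2) * S (S \<eta>)" for d
      by (simp add: z_def eval_nat_numeral)
    have range_z: "R = range z"
    proof
      show "range z \<subseteq> R"
        unfolding R_conjugates \<eta>_def[symmetric] z3 by blast
      show "R \<subseteq> range z"
      proof
        fix x assume "x \<in> R"
        then obtain a b c where "x = of_int a * \<eta> + of_int b * S \<eta> + of_int c * S (S \<eta>)"
          unfolding R_conjugates \<eta>_def[symmetric] by blast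
        \<comment> \<open>The default value \<open>c\<close> serves the index 2.\<close>
        then have "x = z ((\<lambda>_. c)(0 := a, 1 := b))"
          by (simp add: z3)
        then show "x \<in> range z" by blast
      qed
    qed
    have \<iota>_of_int: "\<iota> (of_int n) = of_int n" for n
      by (rule ord.\<iota>_of_int)
    have "(\<Sum>k<3. of_int (d k) * (v * \<iota> ((S ^^ k) \<eta>))) = v * \<iota> (z d)" for d v
    proof -
      have "of_int n * (v * x) = v * (of_int n * x)" for n and x :: 'a
        by (metis mult.assoc mult_of_int_commute)
      then show ?thesis
        using \<eta> by (simp add: z3 \<iota> \<iota>_of_int Z_add Z_mult Z_of_int distrib_left eval_nat_numeral)
    qed
    then have *: "\<mm> = {\<Sum>i<3. y ^ i * \<iota> (z (c i)) | c. True}"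
      unfolding mo(6) order_I_def per \<eta>_def[symmetric] by simp
    show ?thesis
    proof
      show "\<mm> \<subseteq> ord.order_set"
      proof
        fix x assume "x \<in> \<mm>"
        then obtain c where "x = (\<Sum>i<3. y ^ i * \<iota> (z (c i)))"
          unfolding * by blast
        then have "x = \<iota> (z (c 0)) + y * \<iota> (z (c 1)) + y * (y * \<iota> (z (c 2)))"
          by (simp add: eval_nat_numeral mult.assoc)
        moreover have "z d \<in> R" for d
          by (simp add: range_z)
        ultimately show "x \<in> ord.order_set"
          unfolding ord.order_set_def by blast
      qed
      show "ord.order_set \<subseteq> \<mm>"
      proof
        fix x assume "x \<in> ord.order_set"
        then obtain a b c where abc: "a \<in> R" "b \<in> R" "c \<in> R" "x = \<iota> a + y * \<iota> b + y * (y * \<iota> c)"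
          by (rule ord.order_E)
        moreover obtain d0 d1 d2 where "a = z d0" "b = z d1" "c = z d2"
          using abc(1-3) unfolding range_z by blast
        ultimately have "x = \<iota> (z d0) + y * \<iota> (z d1) + y * (y * \<iota> (z d2))"
          by simp
        then have "x = (\<Sum>i<3. y ^ i * \<iota> (z (((\<lambda>_. d2)(0 := d0, 1 := d1)) i)))"
          by (simp add: eval_nat_numeral mult.assoc)
        then show "x \<in> \<mm>" unfolding * by blast
      qed
    qed
  qed
  interpret mat: matrix_squares \<mm> r
    using assms(4) ord.order_1 ord.order_diff by unfold_locales (auto simp: \<mm>)
  \<comment> \<open>The set on the right takes the role of \<open>T\<close> in
    \<open>order_subset\<close>.\<close>
  have "\<mm> \<subseteq> {x. sum_of_squares_in r (matrices_over r \<mm>) (entry_mat r 0 0 x)}"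
    unfolding \<mm>
  proof (rule ord.order_subset)
  qed (use mat.SS_entry_add mat.SS_entry_square mat.SS_double in \<open>auto simp: \<mm>\<close>)
  then show ?thesis
    using mat.SS_if_corner assms(5) by blast
qed

end
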